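(* Let $\varphi\colon A\to B$ be a ring homomorphism of Noetherian normal integral domains such that for each prime ideal $P$ of $B$ of height at most one, the localization $A_{\varphi^{-1}(P)}$ is a unique factorization domain. Then there is a well-defined group homomorphism $\operatorname{Cl}(\varphi)\colon\operatorname{Cl}(A)\to\operatorname{Cl}(B)$ given by $[\mathfrak a]\mapsto[(\mathfrak a\otimes_AB)^{**}]$, where $(-)^{**}=\operatorname{Hom}_B(\operatorname{Hom}_B(-,B),B)$.
   Context: A normal integral domain is a Noetherian integral domain integrally closed in its fraction field. For such a ring $R$, a finitely generated $R$-module $M$ is reflexive if the biduality map $M\to\operatorname{Hom}_R(\operatorname{Hom}_R(M,R),R)$ is an isomorphism; $\operatorname{Cl}(R)$ is the group of isomorphism classes $[\mathfrak a]$ of reflexive $R$-modules of rank one (equivalently reflexive ideals), with product $[\mathfrak a][\mathfrak b]=[(\mathfrak a\otimes_R\mathfrak b)^{**}]$ (double dual over $R$), identity $[R]$, inverse $[\operatorname{Hom}_R(\mathfrak a,R)]$. *)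

theory Defs
  imports "HOL-Computational_Algebra.Fraction_Field" "HOL-Computational_Algebra.Polynomial"
begin

definition is_ideal :: "'r::comm_ring_1 set \<Rightarrow> bool" where
  "is_ideal I \<longleftrightarrow> 0 \<in> I \<and> (\<forall>x\<in>I. \<forall>y\<in>I. x + y \<in> I) \<and> (\<forall>r. \<forall>x\<in>I. r * x \<in> I)"

definition prime_ideal :: "'r::comm_ring_1 set \<Rightarrow> bool" where
  "prime_ideal P \<longleftrightarrow> is_ideal P \<and> P \<noteq> UNIV \<and> (\<forall>a b. a * b \<in> P \<longrightarrow> a \<in> P \<or> b \<in> P)"

definition height_le_one :: "'r::comm_ring_1 set \<Rightarrow> bool" where
  "height_le_one P \<longleftrightarrow> prime_ideal P \<and>
     \<not> (\<exists>Q0 Q1. prime_ideal Q0 \<and> prime_ideal Q1 \<and> Q0 \<subset> Q1 \<and> Q1 \<subset> P)"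

definition noetherian_ring :: "'r::comm_ring_1 itself \<Rightarrow> bool" where
  "noetherian_ring _ \<longleftrightarrow> (\<forall>I::'r set. is_ideal I \<longrightarrow>
      (\<exists>S. finite S \<and> S \<subseteq> I \<and> I = {y. \<exists>c. y = (\<Sum>s\<in>S. c s * s)}))"

definition normal_domain :: "'r::idom itself \<Rightarrow> bool" where
  "normal_domain _ \<longleftrightarrow> (\<forall>x::'r fract. (\<exists>p::'r poly. lead_coeff p = 1 \<and>
        poly (map_poly (\<lambda>a. Fraction_Field.Fract a 1) p) x = 0) \<longrightarrow> (\<exists>a. x = Fraction_Field.Fract a 1))"

definition ring_hom_on :: "('r::comm_ring_1 \<Rightarrow> 's::comm_ring_1) \<Rightarrow> bool" where
  "ring_hom_on f \<longleftrightarrow> f 1 = 1 \<and> (\<forall>x y. f (x + y) = f x + f y) \<and> (\<forall>x y. f (x * y) = f x * f y)"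

definition localization :: "'r::idom set \<Rightarrow> 'r fract set" where
  "localization q = {Fraction_Field.Fract a s | a s. s \<notin> q}"

definition dvd_in :: "'k::comm_ring_1 set \<Rightarrow> 'k \<Rightarrow> 'k \<Rightarrow> bool" where
  "dvd_in S a b \<longleftrightarrow> (\<exists>c\<in>S. b = a * c)"

definition unit_in :: "'k::comm_ring_1 set \<Rightarrow> 'k \<Rightarrow> bool" where
  "unit_in S u \<longleftrightarrow> u \<in> S \<and> dvd_in S u 1"

definition prime_in :: "'k::comm_ring_1 set \<Rightarrow> 'k \<Rightarrow> bool" where
  "prime_in S p \<longleftrightarrow> p \<in> S \<and> p \<noteq> 0 \<and> \<not> unit_in S p \<and>
     (\<forall>a\<in>S. \<forall>b\<in>S. dvd_in S p (a * b) \<longrightarrow> dvd_in S p a \<or> dvd_in S p b)"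

definition ufd_subring :: "'k::comm_ring_1 set \<Rightarrow> bool" where
  "ufd_subring S \<longleftrightarrow> (\<forall>x\<in>S. x \<noteq> 0 \<and> \<not> unit_in S x \<longrightarrow>
      (\<exists>ps. ps \<noteq> [] \<and> (\<forall>p\<in>set ps. prime_in S p) \<and> x = prod_list ps))"

record ('r, 'm) rmod =
  mcarr :: "'m set"
  mzero :: 'm
  madd :: "'m \<Rightarrow> 'm \<Rightarrow> 'm"
  msmult :: "'r \<Rightarrow> 'm \<Rightarrow> 'm"

definition is_module :: "('r::comm_ring_1, 'm) rmod \<Rightarrow> bool" where
  "is_module M \<longleftrightarrow> mzero M \<in> mcarr M \<and>
     (\<forall>x\<in>mcarr M. \<forall>y\<in>mcarr M. madd M x y \<in> mcarr M) \<and>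
     (\<forall>r. \<forall>x\<in>mcarr M. msmult M r x \<in> mcarr M) \<and>
     (\<forall>x\<in>mcarr M. \<forall>y\<in>mcarr M. \<forall>z\<in>mcarr M. madd M (madd M x y) z = madd M x (madd M y z)) \<and>
     (\<forall>x\<in>mcarr M. \<forall>y\<in>mcarr M. madd M x y = madd M y x) \<and>
     (\<forall>x\<in>mcarr M. madd M (mzero M) x = x) \<and>
     (\<forall>x\<in>mcarr M. \<exists>y\<in>mcarr M. madd M x y = mzero M) \<and>
     (\<forall>r s. \<forall>x\<in>mcarr M. msmult M (r * s) x = msmult M r (msmult M s x)) \<and>
     (\<forall>r s. \<forall>x\<in>mcarr M. msmult M (r + s) x = madd M (msmult M r x) (msmult M s x)) \<and>
     (\<forall>r. \<forall>x\<in>mcarr M. \<forall>y\<in>mcarr M. msmult M r (madd M x y) = madd M (msmult M r x) (msmult M r y)) \<and>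
     (\<forall>x\<in>mcarr M. msmult M 1 x = x)"

fun lincomb :: "('r, 'm) rmod \<Rightarrow> ('r \<times> 'm) list \<Rightarrow> 'm" where
  "lincomb M [] = mzero M"
| "lincomb M ((r, x) # xs) = madd M (msmult M r x) (lincomb M xs)"

definition fin_gen :: "('r::comm_ring_1, 'm) rmod \<Rightarrow> bool" where
  "fin_gen M \<longleftrightarrow> (\<exists>gs. set gs \<subseteq> mcarr M \<and>
     (\<forall>x\<in>mcarr M. \<exists>cs. length cs = length gs \<and> x = lincomb M (zip cs gs)))"

definition linear_map :: "('r::comm_ring_1, 'm) rmod \<Rightarrow> ('r, 'n) rmod \<Rightarrow> ('m \<Rightarrow> 'n) \<Rightarrow> bool" where
  "linear_map M N f \<longleftrightarrow> (\<forall>x\<in>mcarr M. f x \<in> mcarr N) \<and>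
     (\<forall>x\<in>mcarr M. \<forall>y\<in>mcarr M. f (madd M x y) = madd N (f x) (f y)) \<and>
     (\<forall>r. \<forall>x\<in>mcarr M. f (msmult M r x) = msmult N r (f x))"

definition mod_iso :: "('r::comm_ring_1, 'm) rmod \<Rightarrow> ('r, 'n) rmod \<Rightarrow> bool" where
  "mod_iso M N \<longleftrightarrow> (\<exists>f. linear_map M N f \<and> bij_betw f (mcarr M) (mcarr N))"

definition ring_mod :: "('r::comm_ring_1, 'r) rmod" where
  "ring_mod = \<lparr>mcarr = UNIV, mzero = 0, madd = (+), msmult = (*)\<rparr>"

definition dual :: "('r::comm_ring_1, 'm) rmod \<Rightarrow> ('r, 'm \<Rightarrow> 'r) rmod" where
  "dual M = \<lparr>mcarr = {f. linear_map M ring_mod f \<and> (\<forall>x. x \<notin> mcarr M \<longrightarrow> f x = 0)},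
             mzero = (\<lambda>_. 0),
             madd = (\<lambda>f g x. f x + g x),
             msmult = (\<lambda>r f x. r * f x)\<rparr>"

definition bidual :: "('r::comm_ring_1, 'm) rmod \<Rightarrow> ('r, ('m \<Rightarrow> 'r) \<Rightarrow> 'r) rmod" where
  "bidual M = dual (dual M)"

definition biduality :: "('r::comm_ring_1, 'm) rmod \<Rightarrow> 'm \<Rightarrow> ('m \<Rightarrow> 'r) \<Rightarrow> 'r" where
  "biduality M x = (\<lambda>f. if f \<in> mcarr (dual M) then f x else 0)"

definition reflexive :: "('r::comm_ring_1, 'm) rmod \<Rightarrow> bool" where
  "reflexive M \<longleftrightarrow> is_module M \<and> fin_gen M \<and>
     bij_betw (biduality M) (mcarr M) (mcarr (bidual M))"

definition rank_one :: "('r::comm_ring_1, 'm) rmod \<Rightarrow> bool" where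
  "rank_one M \<longleftrightarrow> (\<exists>x\<in>mcarr M. \<forall>r. msmult M r x = mzero M \<longrightarrow> r = 0) \<and>
     (\<forall>x\<in>mcarr M. \<forall>y\<in>mcarr M. \<exists>r s. (r \<noteq> 0 \<or> s \<noteq> 0) \<and> msmult M r x = msmult M s y)"

text \<open>Elements of Cl(R): isomorphism classes of reflexive modules of rank one.\<close>
definition refl_rank_one :: "('r::comm_ring_1, 'm) rmod \<Rightarrow> bool" where
  "refl_rank_one M \<longleftrightarrow> reflexive M \<and> rank_one M"

definition free_carr :: "'x set \<Rightarrow> ('x \<Rightarrow> 'r::comm_ring_1) set" where
  "free_carr X = {g. finite {x. g x \<noteq> 0} \<and> (\<forall>x. x \<notin> X \<longrightarrow> g x = 0)}"

definition delta :: "'x \<Rightarrow> 'x \<Rightarrow> 'r::comm_ring_1" where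
  "delta x = (\<lambda>y. if y = x then 1 else 0)"

definition span_sub :: "('x \<Rightarrow> 'r::comm_ring_1) set \<Rightarrow> ('x \<Rightarrow> 'r) set" where
  "span_sub Rel = \<Inter>{N. Rel \<subseteq> N \<and> (\<lambda>_. 0) \<in> N \<and> (\<forall>g\<in>N. \<forall>h\<in>N. (\<lambda>x. g x + h x) \<in> N) \<and>
                        (\<forall>r. \<forall>g\<in>N. (\<lambda>x. r * g x) \<in> N)}"

definition quot_free :: "'x set \<Rightarrow> ('x \<Rightarrow> 'r::comm_ring_1) set \<Rightarrow> ('r, ('x \<Rightarrow> 'r) set) rmod" where
  "quot_free X Rel = (let N = span_sub Rel in
     \<lparr>mcarr = (\<lambda>g. {h. (\<lambda>x. h x - g x) \<in> N}) ` free_carr X,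
      mzero = N,
      madd = (\<lambda>A B. {h. \<exists>g\<in>A. \<exists>g'\<in>B. (\<lambda>x. h x - (g x + g' x)) \<in> N}),
      msmult = (\<lambda>r A. {h. \<exists>g\<in>A. (\<lambda>x. h x - r * g x) \<in> N})\<rparr>)"

definition base_change :: "('a::comm_ring_1 \<Rightarrow> 'b::comm_ring_1) \<Rightarrow> ('a, 'm) rmod \<Rightarrow> ('b, ('m \<Rightarrow> 'b) set) rmod" where
  "base_change phi M = quot_free (mcarr M)
     ({(\<lambda>z. delta (madd M x y) z - delta x z - delta y z) | x y. x \<in> mcarr M \<and> y \<in> mcarr M} \<union>
      {(\<lambda>z. delta (msmult M a x) z - phi a * delta x z) | a x. x \<in> mcarr M})"

definition tensor :: "('r::comm_ring_1, 'm) rmod \<Rightarrow> ('r, 'n) rmod \<Rightarrow> ('r, ('m \<times> 'n \<Rightarrow> 'r) set) rmod" where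
  "tensor M N = quot_free (mcarr M \<times> mcarr N)
     ({(\<lambda>z. delta (madd M x x', y) z - delta (x, y) z - delta (x', y) z) | x x' y.
          x \<in> mcarr M \<and> x' \<in> mcarr M \<and> y \<in> mcarr N} \<union>
      {(\<lambda>z. delta (x, madd N y y') z - delta (x, y) z - delta (x, y') z) | x y y'.
          x \<in> mcarr M \<and> y \<in> mcarr N \<and> y' \<in> mcarr N} \<union>
      {(\<lambda>z. delta (msmult M r x, y) z - r * delta (x, y) z) | r x y. x \<in> mcarr M \<and> y \<in> mcarr N} \<union>
      {(\<lambda>z. delta (x, msmult N r y) z - r * delta (x, y) z) | r x y. x \<in> mcarr M \<and> y \<in> mcarr N})"

definition cl_map :: "('a::comm_ring_1 \<Rightarrow> 'b::comm_ring_1) \<Rightarrow> ('a, 'm) rmod \<Rightarrow> ('b, ((('m \<Rightarrow> 'b) set \<Rightarrow> 'b) \<Rightarrow> 'b)) rmod" where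
  "cl_map phi M = bidual (base_change phi M)"

end

(*
  Write M* for the dual. Homomorphisms out of the base change of M to B are the phi-semilinear maps
  M -> B, and homomorphisms out of a tensor product are the bilinear maps, so each module in the
  statement is the dual of a module of semilinear or bilinear forms; both sides of the product formula
  become the dual of the module of phi-bilinear forms M x N -> B.

  The hypothesis enters as follows: if the localization of A at q is a UFD and M is reflexive of rank
  one, then f x lies outside q for some f in M* and x in M, and (f x) y = (f y) x for all y, so M is
  generated by x at q. With q the kernel of phi this gives rank one over B. For a phi-bilinear form on
  M x N it gives the extension to (M (x) N)** at every prime of B of height at most one, and a fraction
  over the Noetherian normal domain B that is integral at all these primes belongs to B.
*)

theory Submission
  imports Defs "HOL-Computational_Algebra.Polynomial_Factorial"
begin

section \<open>Noetherian normal domains and primes of height at most one\<close>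

text \<open>In general \<open>phi\<close> is neither flat nor injective. A fraction over A therefore
  has no image over B, and a prime of B of height at most one may lie over a prime of A of any
  height, where a reflexive module need not be free. This is why freeness is needed exactly at the
  contracted primes, and why every proportionality is kept as an identity without denominators, such
  as \<open>f x * g y = f y * g x\<close>, which \<open>phi\<close> can transport. Localized modules
  are never formed: freeness at a prime is expressed by a value \<open>f x\<close> outside it. The
  tensor products themselves may have torsion and are hard to compare; dualizing discards it, so
  only modules of forms are compared. The delicate direction is to extend a
  \<open>phi\<close>-bilinear form on M x N to the bidual of the tensor product over A, since that
  bidual can contain more than sums of elementary tensors.\<close>

lemma ideal_sum:
  assumes "is_ideal J" "S \<subseteq> J"
  shows "(\<Sum>s\<in>S. c s * s) \<in> J"
  using assms(2)
proof (induction S rule: infinite_finite_induct)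
  case (insert x F)
  then have "c x * x \<in> J" "(\<Sum>s\<in>F. c s * s) \<in> J" using assms(1) by (auto simp: is_ideal_def)
  then show ?case using insert assms(1) by (simp add: is_ideal_def)
qed (use assms(1) in \<open>auto simp: is_ideal_def\<close>)

text \<open>Finite generation rephrased as minimality of \<open>I\<close> among the ideals
  containing \<open>S\<close>, so that chain arguments need not handle coefficients.\<close>

lemma noetherian_generators:
  assumes "noetherian_ring TYPE('r::comm_ring_1)" "is_ideal (I::'r set)"
  obtains S where "finite S" "S \<subseteq> I" "\<And>J. is_ideal J \<Longrightarrow> S \<subseteq> J \<Longrightarrow> I \<subseteq> J"
proof -
  have "\<exists>S. finite S \<and> S \<subseteq> I \<and> I = {y. \<exists>c. y = (\<Sum>s\<in>S. c s * s)}"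
    using assms unfolding noetherian_ring_def by simp
  then obtain S where S: "finite S" "S \<subseteq> I" "I = {y. \<exists>c. y = (\<Sum>s\<in>S. c s * s)}"
    by (elim exE conjE)
  have "I \<subseteq> J" if "is_ideal J" "S \<subseteq> J" for J
  proof
    fix x assume "x \<in> I"
    then obtain c where "x = (\<Sum>s\<in>S. c s * s)" using S(3) by blast
    then show "x \<in> J" using ideal_sum[OF that] by simp
  qed
  then show thesis by (rule that[OF S(1,2)])
qed

text \<open>The finitely many generators of the union already lie in one member of the chain, which
  is therefore the whole union.\<close>

lemma noetherian_chain:
  assumes "noetherian_ring TYPE('r::comm_ring_1)"
    and "\<C> \<noteq> {}" "\<And>I. I \<in> \<C> \<Longrightarrow> is_ideal (I::'r set)" "subset.chain UNIV \<C>"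
  shows "\<Union>\<C> \<in> \<C>"
proof -
  have tot: "\<And>X Y. X \<in> \<C> \<Longrightarrow> Y \<in> \<C> \<Longrightarrow> X \<subseteq> Y \<or> Y \<subseteq> X"
    using assms(4) unfolding subset.chain_def by blast
  have "is_ideal (\<Union>\<C>)"
    unfolding is_ideal_def
  proof (intro conjI ballI allI)
    show "0 \<in> \<Union>\<C>" using assms(2,3) unfolding is_ideal_def by blast
    show "x + y \<in> \<Union>\<C>" if "x \<in> \<Union>\<C>" "y \<in> \<Union>\<C>" for x y
    proof -
      obtain X Y where "x \<in> X" "X \<in> \<C>" "y \<in> Y" "Y \<in> \<C>" using \<open>x \<in> \<Union>\<C>\<close> \<open>y \<in> \<Union>\<C>\<close> by blast
      then obtain Z where "x \<in> Z" "y \<in> Z" "Z \<in> \<C>" using tot[of X Y] by blast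
      then show ?thesis using assms(3)[of Z] unfolding is_ideal_def by blast
    qed
    show "r * x \<in> \<Union>\<C>" if "x \<in> \<Union>\<C>" for r x
      using that assms(3) unfolding is_ideal_def by blast
  qed
  then obtain S where S: "finite S" "S \<subseteq> \<Union>\<C>" "\<And>J. is_ideal J \<Longrightarrow> S \<subseteq> J \<Longrightarrow> \<Union>\<C> \<subseteq> J"
    using noetherian_generators[OF assms(1)] by metis
  obtain J where "J \<in> \<C>" "S \<subseteq> J"
    using finite_subset_Union_chain[OF S(1,2) assms(2,4)] by blast
  then have "\<Union>\<C> = J" using S(3)[of J] assms(3) by blast
  then show ?thesis using \<open>J \<in> \<C>\<close> by simp
qed

text \<open>Zorn's lemma applies because the union of a chain is itself a member of the chain, hence
  an upper bound inside the family.\<close>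

lemma noetherian_maximal:
  assumes "noetherian_ring TYPE('r::comm_ring_1)"
    and "\<A> \<noteq> {}" "\<And>I. I \<in> \<A> \<Longrightarrow> is_ideal (I::'r set)"
  obtains M where "M \<in> \<A>" "\<And>X. X \<in> \<A> \<Longrightarrow> M \<subseteq> X \<Longrightarrow> X = M"
proof -
  have "\<exists>M\<in>\<A>. \<forall>X\<in>\<A>. M \<subseteq> X \<longrightarrow> X = M"
  proof (rule subset_Zorn_nonempty[OF assms(2)])
    fix \<C> assume "\<C> \<noteq> {}" "subset.chain \<A> \<C>"
    then have sub: "\<C> \<subseteq> \<A>" and "subset.chain UNIV \<C>" unfolding subset.chain_def by auto
    then have "\<Union>\<C> \<in> \<C>" by (intro noetherian_chain[OF assms(1) \<open>\<C> \<noteq> {}\<close>]) (use assms(3) in auto)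
    then show "\<Union>\<C> \<in> \<A>" using sub by blast
  qed
  then show thesis using that by blast
qed

section \<open>Integral and almost integral fractions\<close>

lemma normal_integral:
  fixes y :: "'r::idom fract"
  assumes "normal_domain TYPE('r)" "y ^ n = (\<Sum>i<n. to_fract (c i) * y ^ i)"
  shows "y \<in> range to_fract"
proof -
  define p where "p = monom (1::'r) n - (\<Sum>i<n. monom (c i) i)"
  have cf: "coeff p k = (if k = n then 1 else if k < n then - c k else 0)" for k
    by (auto simp: p_def coeff_sum)
  have deg: "degree p = n"
    by (rule antisym) (auto intro: degree_le le_degree simp: cf)
  have "lead_coeff p = 1" by (simp add: deg cf)
  moreover have "poly (map_poly to_fract p) y = 0"
  proof -
    have "poly (map_poly to_fract p) y = (\<Sum>i\<le>n. to_fract (coeff p i) * y ^ i)"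
      by (simp add: poly_altdef degree_map_poly deg coeff_map_poly)
    also have "\<dots> = (\<Sum>i<n. to_fract (coeff p i) * y ^ i) + y ^ n"
      by (simp add: cf flip: lessThan_Suc_atMost)
    also have "(\<Sum>i<n. to_fract (coeff p i) * y ^ i) = (\<Sum>i<n. - (to_fract (c i) * y ^ i))"
      by (rule sum.cong) (auto simp: cf)
    finally show ?thesis by (simp add: assms(2) sum_negf)
  qed
  ultimately show ?thesis
    using assms(1) unfolding normal_domain_def to_fract_def[abs_def] by blast
qed

text \<open>The ideals generated by the first n of the ring elements \<open>d * y ^ i\<close>
  stabilize, so one of these elements is a combination of its predecessors. Cancelling
  \<open>d\<close> leaves a monic equation for \<open>y\<close>.\<close>

lemma normal_noetherian_power_bounded:
  fixes y :: "'r::idom fract"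
  assumes "noetherian_ring TYPE('r)" "normal_domain TYPE('r)"
    and "d \<noteq> 0" "\<And>n. to_fract d * y ^ n \<in> range to_fract"
  shows "y \<in> range to_fract"
proof -
  define a where "a n = inv to_fract (to_fract d * y ^ n)" for n
  have a: "to_fract (a n) = to_fract d * y ^ n" for n
    unfolding a_def by (rule f_inv_into_f[OF assms(4)])
  define I where "I n = {b. \<exists>c. b = (\<Sum>i<n. c i * a i)}" for n :: nat
  have ideal: "is_ideal (I n)" for n
    unfolding is_ideal_def
  proof (intro conjI ballI allI)
    show "0 \<in> I n" unfolding I_def by (intro CollectI exI[of _ "\<lambda>_. 0"]) simp
    show "x + y \<in> I n" if xy: "x \<in> I n" "y \<in> I n" for x y
    proof -
      obtain c c' where "x = (\<Sum>i<n. c i * a i)" "y = (\<Sum>i<n. c' i * a i)"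
        using xy unfolding I_def by (elim CollectE exE)
      then have "x + y = (\<Sum>i<n. (c i + c' i) * a i)" by (simp add: distrib_right sum.distrib)
      then show ?thesis unfolding I_def by (intro CollectI exI)
    qed
    show "r * x \<in> I n" if x: "x \<in> I n" for r x
    proof -
      obtain c where "x = (\<Sum>i<n. c i * a i)" using x unfolding I_def by (elim CollectE exE)
      then have "r * x = (\<Sum>i<n. (r * c i) * a i)" by (simp add: sum_distrib_left mult.assoc)
      then show ?thesis unfolding I_def by (intro CollectI exI)
    qed
  qed
  have step: "I n \<subseteq> I (Suc n)" for n
  proof
    fix b assume "b \<in> I n"
    then obtain c where "b = (\<Sum>i<n. c i * a i)" unfolding I_def by (elim CollectE exE)
    then have "b = (\<Sum>i<Suc n. (if i < n then c i else 0) * a i)" by simp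
    then show "b \<in> I (Suc n)" unfolding I_def by (intro CollectI exI)
  qed
  have mono: "m \<le> n \<Longrightarrow> I m \<subseteq> I n" for m n by (rule lift_Suc_mono_le[of I, OF step])
  have "\<Union>(range I) \<in> range I"
  proof (rule noetherian_chain[OF assms(1)])
    show "subset.chain UNIV (range I)"
      unfolding subset_chain_def
    proof (intro conjI ballI)
      fix X Y assume "X \<in> range I" "Y \<in> range I"
      then obtain m n where "X = I m" "Y = I n" by blast
      then show "X \<subseteq> Y \<or> Y \<subseteq> X" using mono[of m n] mono[of n m] linear[of m n] by blast
    qed simp
    show "is_ideal J" if "J \<in> range I" for J using that ideal by blast
  qed simp
  then obtain n where n: "\<Union>(range I) = I n" by blast
  \<comment> \<open>The coefficients single out the last summand, so \<open>a n\<close> lies in the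
    next ideal and, by stability, already in \<open>I n\<close>.\<close>
  have "a n = (\<Sum>i<Suc n. (if i < n then 0 else 1) * a i)" by simp
  then have "a n \<in> I (Suc n)" unfolding I_def by (intro CollectI exI)
  then have "a n \<in> I n" using n by blast
  then obtain c where c: "a n = (\<Sum>i<n. c i * a i)" unfolding I_def by (elim CollectE exE)
  have ts: "to_fract (sum g A) = (\<Sum>i\<in>A. to_fract (g i))" for g :: "nat \<Rightarrow> 'r" and A
    by (induction A rule: infinite_finite_induct) auto
  have "to_fract d * y ^ n = (\<Sum>i<n. to_fract (c i) * (to_fract d * y ^ i))"
    using arg_cong[OF c, of to_fract] by (simp only: ts a to_fract_mult)
  also have "\<dots> = to_fract d * (\<Sum>i<n. to_fract (c i) * y ^ i)"
    by (simp add: sum_distrib_left mult_ac)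
  finally have "y ^ n = (\<Sum>i<n. to_fract (c i) * y ^ i)" using assms(3) by simp
  then show ?thesis by (rule normal_integral[OF assms(2)])
qed

text \<open>Repeated multiplication by \<open>y\<close>, starting from \<open>d\<close>, stays in
  \<open>Q\<close>; hence \<open>d\<close> clears the denominators of all powers of
  \<open>y\<close>.\<close>

lemma normal_noetherian_stable_ideal:
  fixes y :: "'r::idom fract"
  assumes "noetherian_ring TYPE('r)" "normal_domain TYPE('r)"
    and "d \<in> Q" "d \<noteq> 0" "\<And>x. x \<in> Q \<Longrightarrow> \<exists>x'\<in>Q. to_fract x * y = to_fract x'"
  shows "y \<in> range to_fract"
proof (rule normal_noetherian_power_bounded[OF assms(1,2,4)])
  fix n
  have "\<exists>x\<in>Q. to_fract d * y ^ n = to_fract x"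
  proof (induction n)
    case 0 then show ?case using assms(3) by auto
  next
    case (Suc n)
    then obtain x where "x \<in> Q" "to_fract d * y ^ n = to_fract x" by blast
    moreover obtain x' where "x' \<in> Q" "to_fract x * y = to_fract x'" using assms(5) \<open>x \<in> Q\<close> by blast
    ultimately show ?case by (auto simp: mult_ac intro!: bexI[of _ x'])
  qed
  then show "to_fract d * y ^ n \<in> range to_fract" by blast
qed

text \<open>For \<open>y = a/b\<close> this is the colon ideal (b : a). It is proper exactly if
  \<open>y\<close> lies outside the ring, and its maximal proper instances are associated primes of
  principal ideals.\<close>

definition denominators :: "'r::idom fract \<Rightarrow> 'r set" where
  "denominators y = {r. to_fract r * y \<in> range to_fract}"

lemma denominators_iff: "r \<in> denominators y \<longleftrightarrow> (\<exists>a. to_fract r * y = to_fract a)"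
  by (auto simp: denominators_def)

lemma denominators_ideal: "is_ideal (denominators y)"
  unfolding is_ideal_def denominators_iff
proof (intro conjI ballI allI)
  show "\<exists>a. to_fract 0 * y = to_fract a" by (rule exI[of _ 0]) simp
  show "\<exists>c. to_fract (a + b) * y = to_fract c" if "a \<in> denominators y" "b \<in> denominators y" for a b
    using that by (simp add: denominators_iff distrib_right) (metis to_fract_add)
  show "\<exists>c. to_fract (r * a) * y = to_fract c" if "a \<in> denominators y" for r a
    using that by (simp add: denominators_iff mult.assoc) (metis to_fract_mult)
qed

lemma denominators_mult: "denominators y \<subseteq> denominators (to_fract r * y)"
proof
  fix s assume "s \<in> denominators y"
  then obtain a where "to_fract s * y = to_fract a" by (auto simp: denominators_iff)
  then have "to_fract s * (to_fract r * y) = to_fract (r * a)" by (simp add: mult.left_commute)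
  then show "s \<in> denominators (to_fract r * y)" unfolding denominators_iff by blast
qed

text \<open>Let \<open>P\<close> be the ideal of denominators of \<open>y\<close>. If \<open>y P \<subseteq> P\<close>, then \<open>y\<close> is integral. Otherwise
  \<open>y p = u\<close> with \<open>p \<in> P\<close> and \<open>u \<notin> P\<close>, which forces \<open>y Q \<subseteq> Q\<close> for every prime \<open>Q \<subset> P\<close>.\<close>

lemma maximal_denominators_height_le_one:
  fixes y :: "'r::idom fract"
  assumes "noetherian_ring TYPE('r)" "normal_domain TYPE('r)" "y \<notin> range to_fract"
    and max: "\<And>z. z \<notin> range to_fract \<Longrightarrow> denominators y \<subseteq> denominators z \<Longrightarrow> denominators z = denominators y"
  shows "height_le_one (denominators y)"
proof -
  let ?P = "denominators y"
  have ideal: "is_ideal ?P" by (rule denominators_ideal)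
  have one: "1 \<notin> ?P" using assms(3) by (simp add: denominators_def)
  \<comment> \<open>If \<open>a\<close> is not a denominator of \<open>y\<close>, then
    \<open>a y\<close> is again outside the ring and has at least the denominators of
    \<open>y\<close>; by maximality it has no others.\<close>
  have prime: "b \<in> ?P" if "a * b \<in> ?P" "a \<notin> ?P" for a b
  proof -
    have "to_fract a * y \<notin> range to_fract" using that(2) by (simp add: denominators_def)
    then have "denominators (to_fract a * y) = ?P" using max denominators_mult by blast
    moreover have "b \<in> denominators (to_fract a * y)" using that(1) by (simp add: denominators_def mult_ac)
    ultimately show ?thesis by blast
  qed
  have P: "prime_ideal ?P" unfolding prime_ideal_def using ideal one prime by blast
  obtain d where d: "d \<in> ?P" "d \<noteq> 0"
  proof -
    obtain a b where "y = Fraction_Field.Fract a b" "b \<noteq> 0" by (cases y) auto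
    then have "to_fract b * y = to_fract a" by (simp add: Fract_conv_to_fract)
    then show thesis using that \<open>b \<noteq> 0\<close> by (auto simp: denominators_def)
  qed
  have "\<exists>p u. p \<in> ?P \<and> to_fract p * y = to_fract u \<and> u \<notin> ?P"
  proof (rule ccontr)
    assume neg: "\<not> ?thesis"
    have "\<exists>x'\<in>?P. to_fract x * y = to_fract x'" if x: "x \<in> ?P" for x
    proof -
      obtain r where "to_fract x * y = to_fract r" using x denominators_iff by blast
      then show ?thesis using neg x by blast
    qed
    then show False using normal_noetherian_stable_ideal[OF assms(1,2) d] assms(3) by blast
  qed
  then obtain p u where p: "p \<in> ?P" "to_fract p * y = to_fract u" "u \<notin> ?P" by blast
  have Q0: "Q = {0}" if Q: "prime_ideal Q" "Q \<subset> ?P" for Q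
  proof (rule ccontr)
    assume "Q \<noteq> {0}"
    moreover have "0 \<in> Q" using Q unfolding prime_ideal_def is_ideal_def by blast
    ultimately obtain e where e: "e \<in> Q" "e \<noteq> 0" by blast
    have u: "u \<notin> Q" using p Q by blast
    have absorb: "r * x \<in> Q" if "x \<in> Q" for r x using Q that unfolding prime_ideal_def is_ideal_def by blast
    have split: "a \<in> Q \<or> b \<in> Q" if "a * b \<in> Q" for a b using Q that unfolding prime_ideal_def by blast
    \<comment> \<open>Two ways of computing \<open>p x y\<close>. The relation trades the fraction
      \<open>y\<close> for the ring elements \<open>u\<close> and \<open>p\<close>, neither of which
      turns out to lie in \<open>Q\<close>.\<close>
    have rel: "u * x = p * r" if "to_fract x * y = to_fract r" for x r
    proof -
      have "to_fract (u * x) = to_fract (p * r)"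
        by (simp only: to_fract_mult p(2)[symmetric] that[symmetric] mult_ac)
      then show ?thesis by (rule to_fract_eq_iff[THEN iffD1])
    qed
    \<comment> \<open>With \<open>p\<close> in \<open>Q\<close>, \<open>rel\<close> would put
      \<open>u * x\<close> into \<open>Q\<close> for every \<open>x\<close> in \<open>?P\<close>;
      since \<open>u\<close> is not in \<open>Q\<close>, all of \<open>?P\<close> would lie in
      \<open>Q\<close>.\<close>
    have "p \<notin> Q"
    proof
      assume "p \<in> Q"
      have "x \<in> Q" if x: "x \<in> ?P" for x
      proof -
        obtain r where "to_fract x * y = to_fract r" using x by (auto simp: denominators_def)
        then have "u * x \<in> Q" using rel[of x r] absorb[OF \<open>p \<in> Q\<close>, of r] by (simp add: mult.commute)
        then show ?thesis using split u by blast
      qed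
      then show False using Q by blast
    qed
    have "\<exists>x'\<in>Q. to_fract x * y = to_fract x'" if x: "x \<in> Q" for x
    proof -
      obtain r where r: "to_fract x * y = to_fract r" using x Q by (auto simp: denominators_def)
      then have "p * r \<in> Q" using rel[of x r] absorb[OF x, of u] by simp
      then show ?thesis using split \<open>p \<notin> Q\<close> r by blast
    qed
    then show False using normal_noetherian_stable_ideal[OF assms(1,2) e] assms(3) by blast
  qed
  \<comment> \<open>In a chain \<open>Q0 \<subset> Q1 \<subset> ?P\<close> both smaller primes would
    be zero.\<close>
  then show ?thesis unfolding height_le_one_def using P by blast
qed

text \<open>A Noetherian normal domain is the intersection of its localizations at primes of height
  at most one, stated for a fraction \<open>a/b\<close> without localizing. If \<open>a/b\<close> is
  not in the ring, its denominators lie in a maximal proper ideal of denominators, and this is such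
  a prime.\<close>

lemma normal_noetherian_dvd_local:
  fixes a b :: "'r::idom"
  assumes "noetherian_ring TYPE('r)" "normal_domain TYPE('r)" "b \<noteq> 0"
    and loc: "\<And>P. height_le_one P \<Longrightarrow> \<exists>s. s \<notin> P \<and> b dvd s * a"
  shows "b dvd a"
proof (rule ccontr)
  assume ndvd: "\<not> b dvd a"
  define x where "x = to_fract a / to_fract b"
  have bx: "to_fract b * x = to_fract a" using assms(3) by (simp add: x_def)
  have den: "s \<in> denominators x" if dv: "b dvd s * a" for s
  proof -
    obtain c where "s * a = b * c" using dv by (rule dvdE)
    then have "to_fract s * x = to_fract c"
      using assms(3) by (simp add: x_def nonzero_divide_eq_eq mult_ac flip: to_fract_mult)
    then show ?thesis by (simp add: denominators_def)
  qed
  have "x \<notin> range to_fract"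
  proof
    assume "x \<in> range to_fract"
    then obtain c where "x = to_fract c" by blast
    then have "b * c = a" using bx by (simp flip: to_fract_mult)
    then show False using ndvd by (metis dvd_triv_left)
  qed
  define \<A> where "\<A> = {denominators z | z. z \<notin> range to_fract \<and> denominators x \<subseteq> denominators z}"
  have "\<A> \<noteq> {}" using \<open>x \<notin> range to_fract\<close> by (auto simp: \<A>_def)
  moreover have "is_ideal I" if "I \<in> \<A>" for I using that denominators_ideal by (auto simp: \<A>_def)
  ultimately obtain P where P: "P \<in> \<A>" "\<And>X. X \<in> \<A> \<Longrightarrow> P \<subseteq> X \<Longrightarrow> X = P"
    by (rule noetherian_maximal[OF assms(1)]) blast+
  then obtain y where y: "y \<notin> range to_fract" "denominators x \<subseteq> denominators y" "P = denominators y"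
    by (auto simp: \<A>_def)
  have "height_le_one (denominators y)"
  proof (rule maximal_denominators_height_le_one[OF assms(1,2) y(1)])
    fix z :: "'r fract" assume "z \<notin> range to_fract" "denominators y \<subseteq> denominators z"
    then show "denominators z = denominators y" using P(2)[of "denominators z"] y unfolding \<A>_def by blast
  qed
  from loc[OF this] den y(2) show False by blast
qed

section \<open>Modules of functions\<close>

lemma is_moduleD:
  assumes "is_module M"
  shows "mzero M \<in> mcarr M"
    and "\<And>x y. x \<in> mcarr M \<Longrightarrow> y \<in> mcarr M \<Longrightarrow> madd M x y \<in> mcarr M"
    and "\<And>r x. x \<in> mcarr M \<Longrightarrow> msmult M r x \<in> mcarr M"
    and "\<And>x. x \<in> mcarr M \<Longrightarrow> msmult M 1 x = x"
    and "\<And>r s x. x \<in> mcarr M \<Longrightarrow> msmult M (r * s) x = msmult M r (msmult M s x)"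
    and "\<And>x. x \<in> mcarr M \<Longrightarrow> madd M (mzero M) x = x"
  using assms unfolding is_module_def by auto

text \<open>The inverse is linear because the operations of \<open>M\<close> stay in
  \<open>mcarr M\<close>, where \<open>g\<close> inverts \<open>f\<close>. This is the source of the
  module hypothesis here and in \<open>mod_iso_sym\<close>.\<close>

lemma mod_isoE:
  assumes "is_module M" "mod_iso M N"
  obtains f g where "linear_map M N f" "linear_map N M g"
    "\<And>x. x \<in> mcarr M \<Longrightarrow> g (f x) = x" "\<And>y. y \<in> mcarr N \<Longrightarrow> f (g y) = y"
proof -
  obtain f where f: "linear_map M N f" "bij_betw f (mcarr M) (mcarr N)"
    using assms(2) unfolding mod_iso_def by blast
  define g where "g = inv_into (mcarr M) f"
  have g: "g y \<in> mcarr M" "f (g y) = y" if "y \<in> mcarr N" for y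
    using that f(2) unfolding g_def bij_betw_def by (auto intro: inv_into_into f_inv_into_f)
  have gf: "g (f x) = x" if "x \<in> mcarr M" for x
    using that f(2) unfolding g_def bij_betw_def by simp
  note M = is_moduleD[OF assms(1)]
  have "linear_map N M g"
    unfolding linear_map_def
  proof (intro conjI ballI allI)
    fix x y assume "x \<in> mcarr N" "y \<in> mcarr N"
    then have "g x \<in> mcarr M" "g y \<in> mcarr M" "madd N x y = f (madd M (g x) (g y))"
      using f(1) g by (auto simp: linear_map_def)
    then show "g (madd N x y) = madd M (g x) (g y)" by (simp add: gf M)
  next
    fix r x assume "x \<in> mcarr N"
    then have "g x \<in> mcarr M" "msmult N r x = f (msmult M r (g x))"
      using f(1) g by (auto simp: linear_map_def)
    then show "g (msmult N r x) = msmult M r (g x)" by (simp add: gf M)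
  qed (use g in auto)
  then show thesis by (rule that[OF f(1) _ gf g(2)])
qed

lemma mod_isoI:
  assumes "linear_map M N f" "linear_map N M g"
    and "\<And>x. x \<in> mcarr M \<Longrightarrow> g (f x) = x" "\<And>y. y \<in> mcarr N \<Longrightarrow> f (g y) = y"
  shows "mod_iso M N"
proof -
  have "bij_betw f (mcarr M) (mcarr N)"
    by (rule bij_betw_byWitness[of _ g]) (use assms in \<open>auto simp: linear_map_def\<close>)
  then show ?thesis using assms(1) unfolding mod_iso_def by blast
qed

lemma mod_iso_sym:
  assumes "is_module M" "mod_iso M N"
  shows "mod_iso N M"
  using assms by (rule mod_isoE) (rule mod_isoI)

lemma mod_iso_trans [trans]:
  assumes "mod_iso M N" "mod_iso N L"
  shows "mod_iso M L"
proof -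
  obtain f g where f: "linear_map M N f" "bij_betw f (mcarr M) (mcarr N)"
    and g: "linear_map N L g" "bij_betw g (mcarr N) (mcarr L)"
    using assms unfolding mod_iso_def by blast
  have "linear_map M L (g \<circ> f)" using f(1) g(1) by (simp add: linear_map_def)
  moreover have "bij_betw (g \<circ> f) (mcarr M) (mcarr L)" by (rule bij_betw_trans[OF f(2) g(2)])
  ultimately show ?thesis unfolding mod_iso_def by blast
qed

text \<open>Duals and modules of semilinear or bilinear forms all have this shape, so isomorphisms
  between them can be checked through \<open>fun_mod_isoI\<close> alone.\<close>

definition fun_mod :: "('x \<Rightarrow> 'r::comm_ring_1) set \<Rightarrow> ('r, 'x \<Rightarrow> 'r) rmod" where
  "fun_mod C = \<lparr>mcarr = C, mzero = (\<lambda>_. 0), madd = (\<lambda>f g x. f x + g x), msmult = (\<lambda>r f x. r * f x)\<rparr>"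

lemma fun_mod_simps [simp]:
  "mcarr (fun_mod C) = C" "mzero (fun_mod C) = (\<lambda>_. 0)"
  "madd (fun_mod C) f g = (\<lambda>x. f x + g x)" "msmult (fun_mod C) r f = (\<lambda>x. r * f x)"
  by (simp_all add: fun_mod_def)

definition fun_submodule :: "('x \<Rightarrow> 'r::comm_ring_1) set \<Rightarrow> bool" where
  "fun_submodule C \<longleftrightarrow> (\<lambda>_. 0) \<in> C \<and> (\<forall>f\<in>C. \<forall>g\<in>C. (\<lambda>x. f x + g x) \<in> C) \<and>
     (\<forall>r. \<forall>f\<in>C. (\<lambda>x. r * f x) \<in> C)"

lemma fun_submoduleD:
  assumes "fun_submodule C"
  shows "(\<lambda>_. 0) \<in> C" "\<And>f g. f \<in> C \<Longrightarrow> g \<in> C \<Longrightarrow> (\<lambda>x. f x + g x) \<in> C"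
    "\<And>r f. f \<in> C \<Longrightarrow> (\<lambda>x. r * f x) \<in> C"
  using assms unfolding fun_submodule_def by blast+

lemma is_module_fun_mod:
  assumes "fun_submodule C"
  shows "is_module (fun_mod C)"
proof -
  have "\<exists>g\<in>C. (\<lambda>x. f x + g x) = (\<lambda>_. 0)" if "f \<in> C" for f
    using fun_submoduleD(3)[OF assms that, of "-1"] by (rule bexI[rotated]) simp
  then show ?thesis
    unfolding is_module_def using fun_submoduleD[OF assms]
    by (simp add: algebra_simps)
qed

lemma fun_mod_isoI:
  assumes "\<And>f. f \<in> C \<Longrightarrow> F f \<in> D"
    and "\<And>f g. f \<in> C \<Longrightarrow> g \<in> C \<Longrightarrow> F (\<lambda>x. f x + g x) = (\<lambda>x. F f x + F g x)"
    and "\<And>r f. f \<in> C \<Longrightarrow> F (\<lambda>x. r * f x) = (\<lambda>x. r * F f x)"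
    and "\<And>f g. f \<in> C \<Longrightarrow> g \<in> C \<Longrightarrow> F f = F g \<Longrightarrow> f = g"
    and "\<And>h. h \<in> D \<Longrightarrow> \<exists>f\<in>C. F f = h"
  shows "mod_iso (fun_mod C) (fun_mod D)"
proof -
  have "linear_map (fun_mod C) (fun_mod D) F"
    using assms(1-3) unfolding linear_map_def by simp
  moreover have "bij_betw F C D"
    unfolding bij_betw_def inj_on_def
  proof (intro conjI ballI impI)
    show "F ` C = D"
    proof
      show "F ` C \<subseteq> D" using assms(1) by blast
      show "D \<subseteq> F ` C" using assms(5) by blast
    qed
  qed (use assms(4) in blast)
  ultimately show ?thesis unfolding mod_iso_def by auto
qed

text \<open>Functions vanish off the carrier, so that they are determined by their values on it.\<close>

definition semilinear :: "('a::comm_ring_1 \<Rightarrow> 'b::comm_ring_1) \<Rightarrow> ('a, 'm) rmod \<Rightarrow> ('m \<Rightarrow> 'b) set" where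
  "semilinear phi M = {f. (\<forall>x\<in>mcarr M. \<forall>y\<in>mcarr M. f (madd M x y) = f x + f y) \<and>
     (\<forall>r. \<forall>x\<in>mcarr M. f (msmult M r x) = phi r * f x) \<and> (\<forall>x. x \<notin> mcarr M \<longrightarrow> f x = 0)}"

text \<open>With the identity for \<open>phi\<close> these are the ordinary bilinear forms dual to a
  tensor product; with the given homomorphism they are the common target of both sides of the
  product formula.\<close>

definition bilinear :: "('a::comm_ring_1 \<Rightarrow> 'b::comm_ring_1) \<Rightarrow> ('a, 'm) rmod \<Rightarrow> ('a, 'n) rmod \<Rightarrow> ('m \<times> 'n \<Rightarrow> 'b) set" where
  "bilinear phi M N = {b.
     (\<forall>x\<in>mcarr M. \<forall>x'\<in>mcarr M. \<forall>y\<in>mcarr N. b (madd M x x', y) = b (x, y) + b (x', y)) \<and>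
     (\<forall>x\<in>mcarr M. \<forall>y\<in>mcarr N. \<forall>y'\<in>mcarr N. b (x, madd N y y') = b (x, y) + b (x, y')) \<and>
     (\<forall>r. \<forall>x\<in>mcarr M. \<forall>y\<in>mcarr N. b (msmult M r x, y) = phi r * b (x, y)) \<and>
     (\<forall>r. \<forall>x\<in>mcarr M. \<forall>y\<in>mcarr N. b (x, msmult N r y) = phi r * b (x, y)) \<and>
     (\<forall>z. z \<notin> mcarr M \<times> mcarr N \<longrightarrow> b z = 0)}"

lemma semilinearD:
  assumes "f \<in> semilinear phi M"
  shows "\<And>x y. x \<in> mcarr M \<Longrightarrow> y \<in> mcarr M \<Longrightarrow> f (madd M x y) = f x + f y"
    and "\<And>r x. x \<in> mcarr M \<Longrightarrow> f (msmult M r x) = phi r * f x"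
    and "\<And>x. x \<notin> mcarr M \<Longrightarrow> f x = 0"
  using assms unfolding semilinear_def by blast+

lemma semilinearI:
  assumes "\<And>x y. x \<in> mcarr M \<Longrightarrow> y \<in> mcarr M \<Longrightarrow> f (madd M x y) = f x + f y"
    and "\<And>r x. x \<in> mcarr M \<Longrightarrow> f (msmult M r x) = phi r * f x"
    and "\<And>x. x \<notin> mcarr M \<Longrightarrow> f x = 0"
  shows "f \<in> semilinear phi M"
  using assms unfolding semilinear_def by blast

lemma semilinear_eqI:
  assumes "f \<in> semilinear phi M" "g \<in> semilinear phi M" "\<And>x. x \<in> mcarr M \<Longrightarrow> f x = g x"
  shows "f = g"
  using assms semilinearD(3) by (metis ext)

lemma bilinearD:
  assumes "b \<in> bilinear phi M N"
  shows "\<And>x x' y. x \<in> mcarr M \<Longrightarrow> x' \<in> mcarr M \<Longrightarrow> y \<in> mcarr N \<Longrightarrow> b (madd M x x', y) = b (x, y) + b (x', y)"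
    and "\<And>x y y'. x \<in> mcarr M \<Longrightarrow> y \<in> mcarr N \<Longrightarrow> y' \<in> mcarr N \<Longrightarrow> b (x, madd N y y') = b (x, y) + b (x, y')"
    and "\<And>r x y. x \<in> mcarr M \<Longrightarrow> y \<in> mcarr N \<Longrightarrow> b (msmult M r x, y) = phi r * b (x, y)"
    and "\<And>r x y. x \<in> mcarr M \<Longrightarrow> y \<in> mcarr N \<Longrightarrow> b (x, msmult N r y) = phi r * b (x, y)"
    and "\<And>x y. x \<notin> mcarr M \<Longrightarrow> b (x, y) = 0"
    and "\<And>x y. y \<notin> mcarr N \<Longrightarrow> b (x, y) = 0"
  using assms unfolding bilinear_def by blast+

lemma bilinearI:
  assumes "\<And>x x' y. x \<in> mcarr M \<Longrightarrow> x' \<in> mcarr M \<Longrightarrow> y \<in> mcarr N \<Longrightarrow> b (madd M x x', y) = b (x, y) + b (x', y)"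
    and "\<And>x y y'. x \<in> mcarr M \<Longrightarrow> y \<in> mcarr N \<Longrightarrow> y' \<in> mcarr N \<Longrightarrow> b (x, madd N y y') = b (x, y) + b (x, y')"
    and "\<And>r x y. x \<in> mcarr M \<Longrightarrow> y \<in> mcarr N \<Longrightarrow> b (msmult M r x, y) = phi r * b (x, y)"
    and "\<And>r x y. x \<in> mcarr M \<Longrightarrow> y \<in> mcarr N \<Longrightarrow> b (x, msmult N r y) = phi r * b (x, y)"
    and "\<And>x y. x \<notin> mcarr M \<or> y \<notin> mcarr N \<Longrightarrow> b (x, y) = 0"
  shows "b \<in> bilinear phi M N"
  unfolding bilinear_def using assms by (simp add: mem_Times_iff)

lemma bilinear_eqI:
  assumes "b \<in> bilinear phi M N" "c \<in> bilinear phi M N"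
    and "\<And>x y. x \<in> mcarr M \<Longrightarrow> y \<in> mcarr N \<Longrightarrow> b (x, y) = c (x, y)"
  shows "b = c"
proof
  fix z show "b z = c z"
    using assms(3) bilinearD(5,6)[OF assms(1)] bilinearD(5,6)[OF assms(2)] by (cases z) metis
qed

lemma fun_submodule_semilinear: "fun_submodule (semilinear phi M)"
  by (auto simp: fun_submodule_def semilinear_def algebra_simps)

lemma fun_submodule_bilinear: "fun_submodule (bilinear phi M N)"
  by (auto simp: fun_submodule_def bilinear_def algebra_simps)

lemma dual_eq: "dual M = fun_mod (semilinear (\<lambda>r. r) M)"
  unfolding dual_def fun_mod_def semilinear_def linear_map_def ring_mod_def by simp

lemma is_module_dual: "is_module (dual M)"
  unfolding dual_eq by (intro is_module_fun_mod fun_submodule_semilinear)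

text \<open>The composite is cut off outside the carrier to respect the normalization of
  forms.\<close>

lemma semilinear_pullback:
  assumes "is_module M" "linear_map M M' k" "f \<in> semilinear phi M'"
  shows "(\<lambda>x. if x \<in> mcarr M then f (k x) else 0) \<in> semilinear phi M"
  using assms(2) is_moduleD[OF assms(1)] semilinearD[OF assms(3)] unfolding linear_map_def
  by (intro semilinearI) auto

lemma semilinear_iso:
  assumes "is_module M" "is_module M'" "mod_iso M M'"
  shows "mod_iso (fun_mod (semilinear phi M)) (fun_mod (semilinear phi M'))"
proof -
  obtain k l where k: "linear_map M M' k" and l: "linear_map M' M l"
    and lk: "\<And>x. x \<in> mcarr M \<Longrightarrow> l (k x) = x" and kl: "\<And>y. y \<in> mcarr M' \<Longrightarrow> k (l y) = y"
    using mod_isoE[OF assms(1,3)] by blast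
  show ?thesis
  proof (rule mod_isoI[where f = "\<lambda>f x. if x \<in> mcarr M' then f (l x) else 0"
        and g = "\<lambda>f x. if x \<in> mcarr M then f (k x) else 0"])
  qed (use semilinear_pullback[OF assms(1) k, where phi = phi] semilinear_pullback[OF assms(2) l, where phi = phi]
        k l lk kl semilinearD(3)[where phi = phi] in \<open>auto simp: linear_map_def fun_eq_iff\<close>)
qed

lemma bilinear_pullback:
  assumes "is_module M" "is_module N" "linear_map M M' k" "linear_map N N' l" "f \<in> bilinear phi M' N'"
  shows "(\<lambda>(x, y). if x \<in> mcarr M \<and> y \<in> mcarr N then f (k x, l y) else 0) \<in> bilinear phi M N"
  using assms(3,4) is_moduleD[OF assms(1)] is_moduleD[OF assms(2)] bilinearD[OF assms(5)]
  unfolding linear_map_def by (intro bilinearI) auto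

lemma bilinear_iso:
  assumes "is_module M" "is_module M'" "is_module N" "is_module N'" "mod_iso M M'" "mod_iso N N'"
  shows "mod_iso (fun_mod (bilinear phi M N)) (fun_mod (bilinear phi M' N'))"
proof -
  obtain k k' where k: "linear_map M M' k" "linear_map M' M k'"
    "\<And>x. x \<in> mcarr M \<Longrightarrow> k' (k x) = x" "\<And>y. y \<in> mcarr M' \<Longrightarrow> k (k' y) = y"
    using mod_isoE[OF assms(1,5)] by blast
  obtain l l' where l: "linear_map N N' l" "linear_map N' N l'"
    "\<And>x. x \<in> mcarr N \<Longrightarrow> l' (l x) = x" "\<And>y. y \<in> mcarr N' \<Longrightarrow> l (l' y) = y"
    using mod_isoE[OF assms(3,6)] by blast
  show ?thesis
  proof (rule mod_isoI[where f = "\<lambda>f (x, y). if x \<in> mcarr M' \<and> y \<in> mcarr N' then f (k' x, l' y) else 0"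
        and g = "\<lambda>f (x, y). if x \<in> mcarr M \<and> y \<in> mcarr N then f (k x, l y) else 0"])
  qed (use bilinear_pullback[OF assms(1,3) k(1) l(1), where phi = phi] bilinear_pullback[OF assms(2,4) k(2) l(2), where phi = phi]
        k l bilinearD(5,6)[where phi = phi] in \<open>auto simp: linear_map_def fun_eq_iff\<close>)
qed

corollary dual_iso: "is_module M \<Longrightarrow> is_module N \<Longrightarrow> mod_iso M N \<Longrightarrow> mod_iso (dual M) (dual N)"
  unfolding dual_eq by (rule semilinear_iso)

section \<open>Duals of free quotients\<close>

text \<open>The linear extension of \<open>u\<close> from the basis of the free module, evaluated at
  \<open>g\<close>. A sum over an infinite support is 0 by convention, hence the finiteness
  assumptions below.\<close>

definition pairing :: "('x \<Rightarrow> 'r::comm_ring_1) \<Rightarrow> ('x \<Rightarrow> 'r) \<Rightarrow> 'r" where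
  "pairing u g = (\<Sum>x\<in>{x. g x \<noteq> 0}. g x * u x)"

lemma pairing_superset:
  assumes "finite A" "{x. g x \<noteq> 0} \<subseteq> A"
  shows "pairing u g = (\<Sum>x\<in>A. g x * u x)"
  unfolding pairing_def by (rule sum.mono_neutral_left) (use assms in auto)

lemma pairing_add:
  assumes "finite {x. g x \<noteq> 0}" "finite {x. h x \<noteq> 0}"
  shows "pairing u (\<lambda>x. g x + h x) = pairing u g + pairing u h"
proof -
  let ?A = "{x. g x \<noteq> 0} \<union> {x. h x \<noteq> 0}"
  have A: "finite ?A" using assms by simp
  have "pairing u (\<lambda>x. g x + h x) = (\<Sum>x\<in>?A. (g x + h x) * u x)"
    by (rule pairing_superset[OF A]) auto
  also have "\<dots> = (\<Sum>x\<in>?A. g x * u x) + (\<Sum>x\<in>?A. h x * u x)"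
    by (simp add: distrib_right sum.distrib)
  also have "(\<Sum>x\<in>?A. g x * u x) = pairing u g" by (rule pairing_superset[symmetric, OF A]) auto
  also have "(\<Sum>x\<in>?A. h x * u x) = pairing u h" by (rule pairing_superset[symmetric, OF A]) auto
  finally show ?thesis .
qed

lemma pairing_smult:
  assumes "finite {x. g x \<noteq> 0}"
  shows "pairing u (\<lambda>x. r * g x) = r * pairing u g"
proof -
  have "pairing u (\<lambda>x. r * g x) = (\<Sum>x\<in>{x. g x \<noteq> 0}. r * g x * u x)"
    by (rule pairing_superset[OF assms]) auto
  then show ?thesis by (simp add: pairing_def sum_distrib_left mult.assoc)
qed

lemma pairing_diff:
  assumes "finite {x. g x \<noteq> 0}" "finite {x. h x \<noteq> 0}"
  shows "pairing u (\<lambda>x. g x - h x) = pairing u g - pairing u h"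
proof -
  have "finite {x. - 1 * h x \<noteq> 0}" using assms(2) by simp
  then have "pairing u (\<lambda>x. g x + - 1 * h x) = pairing u g + - 1 * pairing u h"
    using pairing_add[OF assms(1)] pairing_smult[OF assms(2), of u "- 1"] by metis
  then show ?thesis by simp
qed

lemma finite_delta [simp]: "finite {x. (delta a x :: 'r::comm_ring_1) \<noteq> 0}"
  by (rule finite_subset[of _ "{a}"]) (auto simp: delta_def)

lemma pairing_delta [simp]: "pairing u (delta a) = u a"
proof -
  have "pairing u (delta a) = (\<Sum>x\<in>{a}. delta a x * u x)"
    by (rule pairing_superset) (auto simp: delta_def)
  then show ?thesis by (simp add: delta_def)
qed

text \<open>On the two shapes of defining relations the pairing returns the additivity defect and
  the homogeneity defect of \<open>u\<close>.\<close>

lemma pairing_delta_combination: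
  fixes u :: "'a \<Rightarrow> 'b::comm_ring_1"
  shows "pairing u (\<lambda>z. delta a z - delta b z - delta c z) = u a - u b - u c"
  "pairing u (\<lambda>z. delta a z - r * delta b z) = u a - r * u b"
proof -
  have fin: "finite {z. delta a z - delta b z \<noteq> (0::'b)}" "finite {z. r * delta b z \<noteq> (0::'b)}"
    by (rule finite_subset[of _ "{a, b}"]; auto simp: delta_def split: if_splits)+
  show "pairing u (\<lambda>z. delta a z - delta b z - delta c z) = u a - u b - u c"
    by (simp only: pairing_diff[OF fin(1) finite_delta] pairing_diff[OF finite_delta finite_delta] pairing_delta)
  show "pairing u (\<lambda>z. delta a z - r * delta b z) = u a - r * u b"
    by (simp only: pairing_diff[OF finite_delta fin(2)] pairing_smult[OF finite_delta] pairing_delta)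
qed

lemma pairing_fun_add: "pairing (\<lambda>x. u x + v x) g = pairing u g + pairing v g"
  by (simp add: pairing_def distrib_left sum.distrib)

lemma pairing_fun_smult: "pairing (\<lambda>x. r * u x) g = r * pairing u g"
  by (simp add: pairing_def sum_distrib_left mult.left_commute)

section \<open>The free module, spans of relations and cosets\<close>

lemma fun_submodule_free_carr: "fun_submodule (free_carr X)"
  unfolding fun_submodule_def
proof (intro conjI ballI allI)
  fix g h :: "'a \<Rightarrow> 'b" assume "g \<in> free_carr X" "h \<in> free_carr X"
  then have "finite ({x. g x \<noteq> 0} \<union> {x. h x \<noteq> 0})" by (simp add: free_carr_def)
  then have "finite {x. g x + h x \<noteq> 0}" by (rule rev_finite_subset) auto
  then show "(\<lambda>x. g x + h x) \<in> free_carr X"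
    using \<open>g \<in> free_carr X\<close> \<open>h \<in> free_carr X\<close> by (simp add: free_carr_def)
next
  fix r and g :: "'a \<Rightarrow> 'b" assume g: "g \<in> free_carr X"
  then have "finite {x. g x \<noteq> 0}" by (simp add: free_carr_def)
  then have "finite {x. r * g x \<noteq> 0}" by (rule rev_finite_subset) auto
  then show "(\<lambda>x. r * g x) \<in> free_carr X" using g by (simp add: free_carr_def)
qed (simp add: free_carr_def)

lemma free_carr_finite: "g \<in> free_carr X \<Longrightarrow> finite {x. g x \<noteq> 0}"
  by (simp add: free_carr_def)

lemma fun_submodule_diff:
  assumes "fun_submodule C" "f \<in> C" "g \<in> C"
  shows "(\<lambda>x. f x - g x) \<in> C"
  using fun_submoduleD(2)[OF assms(1,2) fun_submoduleD(3)[OF assms(1,3), of "- 1"]] by simp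

lemma delta_free_carr: "a \<in> X \<Longrightarrow> delta a \<in> free_carr X"
  by (auto simp: free_carr_def) (auto simp: delta_def)

lemma delta_combination_free_carr:
  assumes "a \<in> X" "b \<in> X"
  shows "c \<in> X \<Longrightarrow> (\<lambda>z. delta a z - delta b z - delta c z) \<in> free_carr X"
    and "(\<lambda>z. delta a z - r * delta b z) \<in> free_carr X"
proof -
  note D = fun_submodule_diff[OF fun_submodule_free_carr]
  show "(\<lambda>z. delta a z - delta b z - delta c z) \<in> free_carr X" if "c \<in> X"
    by (rule D[OF D]; rule delta_free_carr; rule assms that)
  show "(\<lambda>z. delta a z - r * delta b z) \<in> free_carr X"
    by (rule D[OF delta_free_carr fun_submoduleD(3)[OF fun_submodule_free_carr delta_free_carr]]; rule assms)
qed

lemma span_sub_alt: "span_sub Rel = \<Inter>{N. Rel \<subseteq> N \<and> fun_submodule N}"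
  by (simp add: span_sub_def fun_submodule_def)

lemma fun_submodule_span: "fun_submodule (span_sub Rel)"
  unfolding span_sub_alt by (auto simp: fun_submodule_def)

lemma span_sub_least: "Rel \<subseteq> N \<Longrightarrow> fun_submodule N \<Longrightarrow> span_sub Rel \<subseteq> N"
  unfolding span_sub_alt by blast

lemma span_sub_superset: "Rel \<subseteq> span_sub Rel"
  unfolding span_sub_alt by blast

text \<open>Names the elements of \<open>quot_free\<close>, so that its set-valued operations can be
  computed on representatives.\<close>

definition coset :: "('x \<Rightarrow> 'r::comm_ring_1) set \<Rightarrow> ('x \<Rightarrow> 'r) \<Rightarrow> ('x \<Rightarrow> 'r) set" where
  "coset N g = {h. (\<lambda>x. h x - g x) \<in> N}"

lemma coset_self: "fun_submodule N \<Longrightarrow> g \<in> coset N g"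
  by (simp add: coset_def fun_submoduleD)

lemma coset_eq:
  assumes "fun_submodule N" "(\<lambda>x. g x - g' x) \<in> N"
  shows "coset N g = coset N g'"
proof -
  have "(\<lambda>x. h x - g' x) \<in> N" if "(\<lambda>x. h x - g x) \<in> N" for h
    using fun_submoduleD(2)[OF assms(1) that assms(2)] by simp
  moreover have "(\<lambda>x. h x - g x) \<in> N" if "(\<lambda>x. h x - g' x) \<in> N" for h
    using fun_submodule_diff[OF assms(1) that assms(2)] by simp
  ultimately show ?thesis by (auto simp: coset_def)
qed

lemma coset_add:
  assumes N: "fun_submodule N"
  shows "{h. \<exists>a\<in>coset N g. \<exists>b\<in>coset N g'. (\<lambda>x. h x - (a x + b x)) \<in> N} = coset N (\<lambda>x. g x + g' x)"
proof (intro equalityI subsetI)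
  fix h assume "h \<in> coset N (\<lambda>x. g x + g' x)"
  then show "h \<in> {h. \<exists>a\<in>coset N g. \<exists>b\<in>coset N g'. (\<lambda>x. h x - (a x + b x)) \<in> N}"
    by (intro CollectI bexI[OF _ coset_self[OF N]]) (simp add: coset_def)
next
  fix h assume "h \<in> {h. \<exists>a\<in>coset N g. \<exists>b\<in>coset N g'. (\<lambda>x. h x - (a x + b x)) \<in> N}"
  then obtain a b where "(\<lambda>x. a x - g x) \<in> N" "(\<lambda>x. b x - g' x) \<in> N" "(\<lambda>x. h x - (a x + b x)) \<in> N"
    by (auto simp: coset_def)
  then have "(\<lambda>x. (h x - (a x + b x)) + ((a x - g x) + (b x - g' x))) \<in> N"
    using fun_submoduleD(2)[OF N] by blast
  then show "h \<in> coset N (\<lambda>x. g x + g' x)" by (simp add: coset_def algebra_simps)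
qed

lemma coset_smult:
  assumes N: "fun_submodule N"
  shows "{h. \<exists>a\<in>coset N g. (\<lambda>x. h x - r * a x) \<in> N} = coset N (\<lambda>x. r * g x)"
proof (intro equalityI subsetI)
  fix h assume "h \<in> coset N (\<lambda>x. r * g x)"
  then show "h \<in> {h. \<exists>a\<in>coset N g. (\<lambda>x. h x - r * a x) \<in> N}"
    by (intro CollectI bexI[OF _ coset_self[OF N]]) (simp add: coset_def)
next
  fix h assume "h \<in> {h. \<exists>a\<in>coset N g. (\<lambda>x. h x - r * a x) \<in> N}"
  then obtain a where "(\<lambda>x. a x - g x) \<in> N" "(\<lambda>x. h x - r * a x) \<in> N"
    by (auto simp: coset_def)
  then have "(\<lambda>x. (h x - r * a x) + r * (a x - g x)) \<in> N"
    using fun_submoduleD(2,3)[OF N] by blast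
  then show "h \<in> coset N (\<lambda>x. r * g x)" by (simp add: coset_def algebra_simps)
qed

lemma quot_free_simps:
  "mcarr (quot_free X Rel) = coset (span_sub Rel) ` free_carr X"
  "mzero (quot_free X Rel) = coset (span_sub Rel) (\<lambda>_. 0)"
  "madd (quot_free X Rel) (coset (span_sub Rel) g) (coset (span_sub Rel) h) = coset (span_sub Rel) (\<lambda>x. g x + h x)"
  "msmult (quot_free X Rel) r (coset (span_sub Rel) g) = coset (span_sub Rel) (\<lambda>x. r * g x)"
  using coset_add[OF fun_submodule_span] coset_smult[OF fun_submodule_span]
  by (simp_all add: quot_free_def Let_def coset_def)

text \<open>The dual of the quotient seen on generators: functions whose linear extension kills the
  relations.\<close>

definition rel_dual :: "'x set \<Rightarrow> ('x \<Rightarrow> 'r::comm_ring_1) set \<Rightarrow> ('x \<Rightarrow> 'r) set" where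
  "rel_dual X Rel = {u. (\<forall>x. x \<notin> X \<longrightarrow> u x = 0) \<and> (\<forall>g\<in>Rel. pairing u g = 0)}"

text \<open>The elements of the free module killed by \<open>u\<close> form a submodule containing
  the relations, hence their span; so the pairing is constant on cosets.\<close>

lemma pairing_coset:
  assumes "Rel \<subseteq> free_carr X" "u \<in> rel_dual X Rel" "g \<in> free_carr X" "h \<in> coset (span_sub Rel) g"
  shows "pairing u h = pairing u g"
proof -
  let ?N = "{g \<in> free_carr X. pairing u g = 0}"
  have "fun_submodule ?N"
    using fun_submodule_free_carr[of X]
    by (auto simp: fun_submodule_def pairing_add pairing_smult free_carr_finite) (simp add: pairing_def)
  then have "span_sub Rel \<subseteq> ?N"
    by (rule span_sub_least[rotated]) (use assms(1,2) in \<open>auto simp: rel_dual_def\<close>)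
  then have d: "(\<lambda>x. h x - g x) \<in> free_carr X" "pairing u (\<lambda>x. h x - g x) = 0"
    using assms(4) by (auto simp: coset_def)
  then have "pairing u (\<lambda>x. (h x - g x) + g x) = pairing u (\<lambda>x. h x - g x) + pairing u g"
    by (intro pairing_add free_carr_finite[OF d(1)] free_carr_finite[OF assms(3)])
  then show ?thesis using d(2) by simp
qed

text \<open>A form on the quotient is determined by the classes of the basis elements. The induction
  removes one basis element from the support at a time.\<close>

lemma dual_quot_free_expand:
  fixes Rel :: "('x \<Rightarrow> 'r::comm_ring_1) set"
  assumes f: "f \<in> mcarr (dual (quot_free X Rel))" and "g \<in> free_carr X"
  shows "f (coset (span_sub Rel) g) = pairing (\<lambda>x. if x \<in> X then f (coset (span_sub Rel) (delta x)) else 0) g"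
    (is "?f g = pairing ?u g")
proof -
  have f: "f \<in> semilinear (\<lambda>r. r) (quot_free X Rel)" using f by (simp add: dual_eq)
  have add: "?f (\<lambda>x. g x + h x) = ?f g + ?f h" if "g \<in> free_carr X" "h \<in> free_carr X" for g h
    using semilinearD(1)[OF f, of "coset (span_sub Rel) g" "coset (span_sub Rel) h"] that
    by (simp add: quot_free_simps)
  have sm: "?f (\<lambda>x. r * g x) = r * ?f g" if "g \<in> free_carr X" for r g
    using semilinearD(2)[OF f, of "coset (span_sub Rel) g" r] that by (simp add: quot_free_simps)
  have z: "(\<lambda>_. 0) \<in> free_carr X" by (rule fun_submoduleD(1)[OF fun_submodule_free_carr])
  have "finite {x. g x \<noteq> 0}" using assms(2) by (rule free_carr_finite)
  moreover have "\<forall>g. g \<in> free_carr X \<and> {x. g x \<noteq> 0} \<subseteq> S \<longrightarrow> ?f g = pairing ?u g" if "finite S" for S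
    using that
  proof (induction S)
    case empty
    have "?f (\<lambda>_. 0) = 0" using sm[OF z, of 0] by simp
    moreover have "g = (\<lambda>_. 0)" if "{x. g x \<noteq> 0} \<subseteq> {}" for g :: "'x \<Rightarrow> 'r" using that by auto
    ultimately show ?case by (auto simp: pairing_def)
  next
    case (insert a S)
    show ?case
    proof (intro allI impI, elim conjE)
      fix g :: "'x \<Rightarrow> 'r" assume g: "g \<in> free_carr X" "{x. g x \<noteq> 0} \<subseteq> insert a S"
      show "?f g = pairing ?u g"
      proof (cases "g a = 0")
        case True
        then have "{x. g x \<noteq> 0} \<subseteq> S" using g(2) by auto
        then show ?thesis using insert.IH g(1) by blast
      next
        case False
        then have a: "a \<in> X" using g(1) by (auto simp: free_carr_def)
        define h where "h x = g x - g a * delta a x" for x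
        have ga: "(\<lambda>x. g a * delta a x) \<in> free_carr X"
          by (rule fun_submoduleD(3)[OF fun_submodule_free_carr delta_free_carr[OF a]])
        then have h: "h \<in> free_carr X"
          unfolding h_def using fun_submodule_diff[OF fun_submodule_free_carr g(1)] by blast
        have "{x. h x \<noteq> 0} \<subseteq> S" using g(2) by (auto simp: h_def delta_def split: if_splits)
        then have IH: "?f h = pairing ?u h" using insert.IH h by blast
        have gh: "g = (\<lambda>x. h x + g a * delta a x)" by (simp add: h_def)
        have "?f g = ?f h + g a * ?f (delta a)"
          by (subst gh) (simp add: add[OF h ga] sm[OF delta_free_carr[OF a]])
        also have "\<dots> = pairing ?u h + g a * pairing ?u (delta a)" using IH a by simp
        also have "\<dots> = pairing ?u (\<lambda>x. h x + g a * delta a x)"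
          by (simp only: pairing_add[OF free_carr_finite[OF h] free_carr_finite[OF ga]] pairing_smult[OF finite_delta])
        finally show ?thesis using gh by simp
      qed
    qed
  qed
  ultimately show ?thesis using assms(2) by blast
qed

lemma dual_quot_free:
  assumes Rel: "Rel \<subseteq> free_carr X"
  shows "mod_iso (fun_mod (rel_dual X Rel)) (dual (quot_free X (Rel :: ('x \<Rightarrow> 'r::comm_ring_1) set)))"
proof -
  let ?Q = "quot_free X Rel" and ?c = "coset (span_sub Rel)"
  \<comment> \<open>The representative is arbitrary; \<open>pairing_coset\<close> makes the value
    independent of it.\<close>
  define F where "F u A = (if A \<in> mcarr ?Q then pairing u (SOME g. g \<in> A) else 0)"
    for u :: "'x \<Rightarrow> 'r" and A
  have F: "F u (?c g) = pairing u g" if "u \<in> rel_dual X Rel" "g \<in> free_carr X" for u g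
  proof -
    have "(SOME h. h \<in> ?c g) \<in> ?c g" by (rule someI[of "\<lambda>h. h \<in> ?c g", OF coset_self[OF fun_submodule_span]])
    then show ?thesis using pairing_coset[OF Rel that] that(2) by (simp add: F_def quot_free_simps)
  qed
  have Fc: "F u A = 0" if "A \<notin> mcarr ?Q" for u A using that by (simp add: F_def)
  have free: "(\<lambda>x. g x + h x) \<in> free_carr X" "(\<lambda>x. r * g x) \<in> free_carr X"
    if "g \<in> free_carr X" "h \<in> free_carr X" for g h :: "'x \<Rightarrow> 'r" and r
    using fun_submoduleD[OF fun_submodule_free_carr] that by blast+
  show ?thesis
    unfolding dual_eq
  proof (rule fun_mod_isoI[where F = F])
    fix u assume u: "u \<in> rel_dual X Rel"
    show "F u \<in> semilinear (\<lambda>r. r) ?Q"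
      by (rule semilinearI)
        (auto simp: quot_free_simps F[OF u] free pairing_add pairing_smult free_carr_finite Fc)
  next
    fix u v assume "u \<in> rel_dual X Rel" "v \<in> rel_dual X Rel"
    then show "F (\<lambda>x. u x + v x) = (\<lambda>x. F u x + F v x)"
      by (auto simp: F_def pairing_fun_add)
  next
    fix r u show "F (\<lambda>x. r * u x) = (\<lambda>x. r * F u x)"
      by (auto simp: F_def pairing_fun_smult)
  next
    fix u v assume uv: "u \<in> rel_dual X Rel" "v \<in> rel_dual X Rel" "F u = F v"
    show "u = v"
    proof
      fix x show "u x = v x"
      proof (cases "x \<in> X")
        case True
        then show ?thesis
          using F[OF uv(1) delta_free_carr] F[OF uv(2) delta_free_carr] uv(3) by simp
      next
        case False then show ?thesis using uv(1,2) by (simp add: rel_dual_def)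
      qed
    qed
  next
    fix f assume f: "f \<in> semilinear (\<lambda>r. r) ?Q"
    let ?u = "\<lambda>x. if x \<in> X then f (?c (delta x)) else 0"
    have fd: "f \<in> mcarr (dual ?Q)" using f by (simp add: dual_eq)
    have z: "(\<lambda>_. 0) \<in> free_carr X" by (rule fun_submoduleD(1)[OF fun_submodule_free_carr])
    have "pairing ?u g = 0" if "g \<in> Rel" for g
    proof -
      \<comment> \<open>A relation represents the zero class, so the form obtained from
        \<open>f\<close> vanishes on it.\<close>
      have "?c g = ?c (\<lambda>_. 0)"
        by (rule coset_eq[OF fun_submodule_span]) (use that span_sub_superset in auto)
      then have "pairing ?u g = pairing ?u (\<lambda>_. 0)"
        using dual_quot_free_expand[OF fd, of g] dual_quot_free_expand[OF fd z] that Rel by auto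
      then show ?thesis by (simp add: pairing_def)
    qed
    then have u: "?u \<in> rel_dual X Rel" by (auto simp: rel_dual_def)
    have "F ?u A = f A" for A
    proof (cases "A \<in> mcarr ?Q")
      case True
      then obtain g where "A = ?c g" "g \<in> free_carr X" by (auto simp: quot_free_simps)
      then show ?thesis using F[OF u] dual_quot_free_expand[OF fd] by simp
    next
      case False then show ?thesis using Fc semilinearD(3)[OF f] by simp
    qed
    then show "\<exists>u\<in>rel_dual X Rel. F u = f" using u by blast
  qed
qed

text \<open>Turns a condition on all relations into quantified axioms in the shape used by
  \<open>semilinear\<close> and \<open>bilinear\<close>.\<close>

lemma ball_family:
  "(\<forall>g\<in>{f x y | x y. x \<in> A \<and> y \<in> B}. Q g) \<longleftrightarrow> (\<forall>x\<in>A. \<forall>y\<in>B. Q (f x y))"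
  "(\<forall>g\<in>{h r x | r x. x \<in> A}. Q g) \<longleftrightarrow> (\<forall>r. \<forall>x\<in>A. Q (h r x))"
  "(\<forall>g\<in>{k x y z | x y z. x \<in> A \<and> y \<in> B \<and> z \<in> C}. Q g) \<longleftrightarrow> (\<forall>x\<in>A. \<forall>y\<in>B. \<forall>z\<in>C. Q (k x y z))"
  "(\<forall>g\<in>{l r x y | r x y. x \<in> A \<and> y \<in> B}. Q g) \<longleftrightarrow> (\<forall>r. \<forall>x\<in>A. \<forall>y\<in>B. Q (l r x y))"
  by blast+

lemma dual_base_change:
  fixes phi :: "'a::comm_ring_1 \<Rightarrow> 'b::comm_ring_1" and M :: "('a, 'm) rmod"
  assumes "is_module M"
  shows "mod_iso (dual (base_change phi M)) (fun_mod (semilinear phi M))"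
proof -
  let ?R = "{(\<lambda>z. delta (madd M x y) z - delta x z - delta y z) | x y. x \<in> mcarr M \<and> y \<in> mcarr M} \<union>
      {(\<lambda>z. delta (msmult M a x) z - phi a * delta x z) | a x. x \<in> mcarr M}"
  note M = is_moduleD[OF assms]
  have free: "?R \<subseteq> free_carr (mcarr M)" using M(2,3) by (auto intro!: delta_combination_free_carr)
  have "rel_dual (mcarr M) ?R = semilinear phi M"
  proof (intro set_eqI)
    fix u :: "'m \<Rightarrow> 'b"
    have "(\<forall>g\<in>?R. pairing u g = 0) \<longleftrightarrow>
      (\<forall>x\<in>mcarr M. \<forall>y\<in>mcarr M. pairing u (\<lambda>z. delta (madd M x y) z - delta x z - delta y z) = 0) \<and>
      (\<forall>a. \<forall>x\<in>mcarr M. pairing u (\<lambda>z. delta (msmult M a x) z - phi a * delta x z) = 0)"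
      by (simp only: ball_Un ball_family conj_assoc)
    note e = this[unfolded pairing_delta_combination]
    show "u \<in> rel_dual (mcarr M) ?R \<longleftrightarrow> u \<in> semilinear phi M"
      unfolding rel_dual_def semilinear_def mem_Collect_eq
      unfolding e unfolding diff_diff_eq right_minus_eq by (rule iffI; elim conjE; intro conjI; assumption)
  qed
  then have "mod_iso (fun_mod (semilinear phi M)) (dual (base_change phi M))"
    using dual_quot_free[OF free] unfolding base_change_def by (simp only:)
  then show ?thesis by (rule mod_iso_sym[OF is_module_fun_mod[OF fun_submodule_semilinear]])
qed

lemma dual_tensor:
  fixes M :: "('r::comm_ring_1, 'm) rmod" and N :: "('r, 'n) rmod"
  assumes "is_module M" "is_module N"
  shows "mod_iso (dual (tensor M N)) (fun_mod (bilinear (\<lambda>r. r) M N))"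
proof -
  let ?R = "{(\<lambda>z. delta (madd M x x', y) z - delta (x, y) z - delta (x', y) z) | x x' y.
          x \<in> mcarr M \<and> x' \<in> mcarr M \<and> y \<in> mcarr N} \<union>
      {(\<lambda>z. delta (x, madd N y y') z - delta (x, y) z - delta (x, y') z) | x y y'.
          x \<in> mcarr M \<and> y \<in> mcarr N \<and> y' \<in> mcarr N} \<union>
      {(\<lambda>z. delta (msmult M r x, y) z - r * delta (x, y) z) | r x y. x \<in> mcarr M \<and> y \<in> mcarr N} \<union>
      {(\<lambda>z. delta (x, msmult N r y) z - r * delta (x, y) z) | r x y. x \<in> mcarr M \<and> y \<in> mcarr N}
      :: ('m \<times> 'n \<Rightarrow> 'r) set"
  note M = is_moduleD[OF assms(1)] and N = is_moduleD[OF assms(2)]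
  have free: "?R \<subseteq> free_carr (mcarr M \<times> mcarr N)" using M(2,3) N(2,3) by (auto intro!: delta_combination_free_carr)
  have "rel_dual (mcarr M \<times> mcarr N) ?R = bilinear (\<lambda>r. r) M N"
  proof (intro set_eqI)
    fix u :: "'m \<times> 'n \<Rightarrow> 'r"
    have "(\<forall>g\<in>?R. pairing u g = 0) \<longleftrightarrow>
      (\<forall>x\<in>mcarr M. \<forall>x'\<in>mcarr M. \<forall>y\<in>mcarr N. pairing u (\<lambda>z. delta (madd M x x', y) z - delta (x, y) z - delta (x', y) z) = 0) \<and>
      (\<forall>x\<in>mcarr M. \<forall>y\<in>mcarr N. \<forall>y'\<in>mcarr N. pairing u (\<lambda>z. delta (x, madd N y y') z - delta (x, y) z - delta (x, y') z) = 0) \<and>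
      (\<forall>r. \<forall>x\<in>mcarr M. \<forall>y\<in>mcarr N. pairing u (\<lambda>z. delta (msmult M r x, y) z - r * delta (x, y) z) = 0) \<and>
      (\<forall>r. \<forall>x\<in>mcarr M. \<forall>y\<in>mcarr N. pairing u (\<lambda>z. delta (x, msmult N r y) z - r * delta (x, y) z) = 0)"
      by (simp only: ball_Un ball_family conj_assoc)
    note e = this[unfolded pairing_delta_combination]
    show "u \<in> rel_dual (mcarr M \<times> mcarr N) ?R \<longleftrightarrow> u \<in> bilinear (\<lambda>r. r) M N"
      unfolding rel_dual_def bilinear_def mem_Collect_eq
      unfolding e unfolding diff_diff_eq right_minus_eq by (rule iffI; elim conjE; intro conjI; assumption)
  qed
  then have "mod_iso (fun_mod (bilinear (\<lambda>r. r) M N)) (dual (tensor M N))"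
    using dual_quot_free[OF free] unfolding tensor_def by (simp only:)
  then show ?thesis by (rule mod_iso_sym[OF is_module_fun_mod[OF fun_submodule_bilinear]])
qed

section \<open>Duals of modules of rank one\<close>

text \<open>A witness that the dual has rank one: over the fraction field every form
  \<open>g\<close> is \<open>g x / f x\<close> times \<open>f\<close>. Torsion in \<open>M\<close>
  is invisible to it, so it suits modules that are not reflexive.\<close>

definition rank_one_at :: "('r::idom, 'm) rmod \<Rightarrow> 'm \<Rightarrow> ('m \<Rightarrow> 'r) \<Rightarrow> bool" where
  "rank_one_at M x f \<longleftrightarrow> x \<in> mcarr M \<and> f \<in> mcarr (dual M) \<and> f x \<noteq> 0 \<and>
     (\<forall>g\<in>mcarr (dual M). \<forall>y. f x * g y = g x * f y)"

lemma mcarr_dual: "mcarr (dual M) = semilinear (\<lambda>r. r) M"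
  by (simp add: dual_eq)

lemmas dual_mapD = semilinearD[where phi = "\<lambda>r. r", folded mcarr_dual]

text \<open>The biduality map for an arbitrary module of functions, so that it also serves
  semilinear and bilinear forms.\<close>

definition eval_at :: "('x \<Rightarrow> 'r::comm_ring_1) set \<Rightarrow> 'x \<Rightarrow> ('x \<Rightarrow> 'r) \<Rightarrow> 'r" where
  "eval_at C x = (\<lambda>f. if f \<in> C then f x else 0)"

lemma biduality_eval_at: "biduality M x = eval_at (mcarr (dual M)) x"
  by (simp add: biduality_def eval_at_def)

lemma eval_at_dual: "fun_submodule C \<Longrightarrow> eval_at C x \<in> mcarr (dual (fun_mod C))"
  unfolding mcarr_dual by (rule semilinearI) (auto simp: eval_at_def fun_submoduleD)

text \<open>Apply a form \<xi> to the identity \<open>f x * g = g x * f\<close> between functions: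
  proportionality of functions becomes proportionality of \<xi> to evaluation at
  \<open>x\<close>.\<close>

lemma rank_one_at_fun_mod:
  assumes "fun_submodule C" "f \<in> C" "f x \<noteq> 0"
    and "\<And>g y. g \<in> C \<Longrightarrow> f x * g y = g x * f y"
  shows "rank_one_at (fun_mod C) f (eval_at C x)"
  unfolding rank_one_at_def
proof (intro conjI ballI allI)
  fix \<xi> g assume \<xi>: "\<xi> \<in> mcarr (dual (fun_mod C))"
  show "eval_at C x f * \<xi> g = \<xi> f * eval_at C x g"
  proof (cases "g \<in> C")
    case True
    have "(\<lambda>y. f x * g y) = (\<lambda>y. g x * f y)" using assms(4)[OF True] by blast
    then have "\<xi> (\<lambda>y. f x * g y) = \<xi> (\<lambda>y. g x * f y)" by simp
    then have "f x * \<xi> g = g x * \<xi> f"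
      using dual_mapD(2)[OF \<xi>, of g "f x"] dual_mapD(2)[OF \<xi>, of f "g x"] True assms(2) by simp
    then show ?thesis using True assms(2) by (simp add: eval_at_def mult.commute)
  next
    case False
    then show ?thesis using dual_mapD(3)[OF \<xi>] by (simp add: eval_at_def)
  qed
qed (use assms eval_at_dual in \<open>auto simp: eval_at_def\<close>)

lemma rank_one_at_dual:
  assumes "rank_one_at M x f"
  shows "rank_one_at (dual M) f (biduality M x)"
  using assms rank_one_at_fun_mod[OF fun_submodule_semilinear, of f "\<lambda>r. r" M x]
  by (simp add: rank_one_at_def biduality_eval_at mcarr_dual dual_eq)

lemma rank_one_at_determined:
  assumes "rank_one_at M x f" "g \<in> mcarr (dual M)" "h \<in> mcarr (dual M)" "g x = h x"
  shows "g = h"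
proof
  fix y
  have "f x * g y = f x * h y" using assms unfolding rank_one_at_def by metis
  then show "g y = h y" using assms(1) unfolding rank_one_at_def by simp
qed

lemma rank_one_at_iso:
  assumes M: "is_module M" and N: "is_module N" and iso: "mod_iso M N" and x: "rank_one_at M x f"
  obtains y g where "rank_one_at N y g"
proof -
  obtain k l where k: "linear_map M N k" and l: "linear_map N M l"
    and lk: "\<And>x. x \<in> mcarr M \<Longrightarrow> l (k x) = x" and kl: "\<And>y. y \<in> mcarr N \<Longrightarrow> k (l y) = y"
    using mod_isoE[OF M iso] by blast
  have xM: "x \<in> mcarr M" "f x \<noteq> 0" and f: "f \<in> mcarr (dual M)"
    and xf: "\<And>g y. g \<in> mcarr (dual M) \<Longrightarrow> f x * g y = g x * f y"
    using x unfolding rank_one_at_def by blast+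
  have kx: "k x \<in> mcarr N" using k xM by (simp add: linear_map_def)
  let ?f = "\<lambda>y. if y \<in> mcarr N then f (l y) else 0"
  have "rank_one_at N (k x) ?f"
    unfolding rank_one_at_def
  proof (intro conjI ballI allI)
    show "?f \<in> mcarr (dual N)"
      using semilinear_pullback[OF N l f[unfolded mcarr_dual]] by (simp add: mcarr_dual)
    show "?f (k x) \<noteq> 0" using kx xM lk by simp
    fix g y assume g: "g \<in> mcarr (dual N)"
    let ?g = "\<lambda>x. if x \<in> mcarr M then g (k x) else 0"
    have "?g \<in> mcarr (dual M)"
      using semilinear_pullback[OF M k g[unfolded mcarr_dual]] by (simp add: mcarr_dual)
    then have "f x * ?g (l y) = ?g x * f (l y)" by (rule xf)
    then show "?f (k x) * g y = g (k x) * ?f y"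
      using kx xM lk kl l dual_mapD(3)[OF g] by (auto simp: linear_map_def)
  qed (rule kx)
  then show thesis by (rule that)
qed

lemma lincomb_fun_mod:
  "distinct ss \<Longrightarrow> lincomb (fun_mod C) (zip (map c ss) (map F ss)) = (\<lambda>y. \<Sum>s\<in>set ss. c s * F s y)"
  by (induction ss) auto

lemma fun_submodule_sum:
  assumes "fun_submodule C" "\<And>s. s \<in> S \<Longrightarrow> F s \<in> C"
  shows "(\<lambda>y. \<Sum>s\<in>S. c s * F s y) \<in> C"
  using assms(2)
proof (induction S rule: infinite_finite_induct)
  case (insert s S)
  have "(\<lambda>y. c s * F s y) \<in> C" by (rule fun_submoduleD(3)[OF assms(1)]) (simp add: insert)
  moreover have "(\<lambda>y. \<Sum>s\<in>S. c s * F s y) \<in> C" by (rule insert.IH) (simp add: insert)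
  ultimately have "(\<lambda>y. c s * F s y + (\<Sum>s\<in>S. c s * F s y)) \<in> C" by (rule fun_submoduleD(2)[OF assms(1)])
  then show ?case using insert.hyps by simp
qed (simp_all add: fun_submoduleD(1)[OF assms(1)])

text \<open>Evaluation at \<open>x\<close> embeds the dual into the ring, so it is isomorphic to an ideal.\<close>

lemma fin_gen_dual:
  fixes M :: "('r::idom, 'm) rmod"
  assumes noeth: "noetherian_ring TYPE('r)" and x: "rank_one_at M x f"
  shows "fin_gen (dual M)"
proof -
  let ?D = "mcarr (dual M)"
  have sub: "fun_submodule ?D" unfolding mcarr_dual by (rule fun_submodule_semilinear)
  define I where "I = (\<lambda>g. g x) ` ?D"
  have "is_ideal I"
    unfolding is_ideal_def
  proof (intro conjI ballI allI)
    show "0 \<in> I" unfolding I_def by (rule image_eqI[OF _ fun_submoduleD(1)[OF sub]]) simp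
    fix a assume "a \<in> I"
    then obtain g where g: "g \<in> ?D" "a = g x" unfolding I_def by blast
    show "r * a \<in> I" for r unfolding I_def by (rule image_eqI[OF _ fun_submoduleD(3)[OF sub g(1), of r]]) (simp add: g)
    fix b assume "b \<in> I"
    then obtain h where h: "h \<in> ?D" "b = h x" unfolding I_def by blast
    show "a + b \<in> I" unfolding I_def
      by (rule image_eqI[OF _ fun_submoduleD(2)[OF sub g(1) h(1)]]) (simp add: g h)
  qed
  then have "\<exists>S. finite S \<and> S \<subseteq> I \<and> I = {y. \<exists>c. y = (\<Sum>s\<in>S. c s * s)}"
    using noeth unfolding noetherian_ring_def by simp
  then obtain S where S: "finite S" "S \<subseteq> I" "I = {y. \<exists>c. y = (\<Sum>s\<in>S. c s * s)}" by (elim exE conjE)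
  obtain ss where ss: "set ss = S" "distinct ss" using finite_distinct_list[OF S(1)] by blast
  define F where "F = inv_into ?D (\<lambda>g. g x)"
  have F: "F s \<in> ?D" "F s x = s" if "s \<in> S" for s
    using that S(2) inv_into_into[of s "\<lambda>g. g x" ?D] f_inv_into_f[of s "\<lambda>g. g x" ?D]
    unfolding I_def F_def by auto
  have "\<exists>cs. length cs = length (map F ss) \<and> g = lincomb (dual M) (zip cs (map F ss))" if g: "g \<in> ?D" for g
  proof -
    have "g x \<in> I" using g unfolding I_def by blast
    then obtain c where c: "g x = (\<Sum>s\<in>S. c s * s)" using S(3) by blast
    let ?h = "\<lambda>y. \<Sum>s\<in>S. c s * F s y"
    have "?h \<in> ?D" by (rule fun_submodule_sum[OF sub F(1)])
    moreover have "g x = ?h x" using c F(2) by simp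
    \<comment> \<open>Agreement at \<open>x\<close> suffices, since a form is determined by its
      value there.\<close>
    ultimately have "g = ?h" using rank_one_at_determined[OF x g] by blast
    also have "\<dots> = lincomb (dual M) (zip (map c ss) (map F ss))"
      unfolding dual_eq lincomb_fun_mod[OF ss(2)] ss(1) by simp
    finally show ?thesis by (intro exI[of _ "map c ss"]) simp
  qed
  moreover have "set (map F ss) \<subseteq> ?D" using F(1) ss(1) by auto
  ultimately show ?thesis unfolding fin_gen_def by blast
qed

text \<open>A form on the double dual is recovered from its restriction to \<open>M\<close> along
  biduality. By rank one, forms on the double dual that agree at the image of \<open>x\<close> are
  equal, so \<open>M\<close> itself may have torsion.\<close>

lemma refl_rank_one_dual:
  fixes M :: "('r::idom, 'm) rmod"
  assumes noeth: "noetherian_ring TYPE('r)" and M: "is_module M" and x: "rank_one_at M x f"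
  shows "refl_rank_one (dual M)"
proof -
  let ?D = "mcarr (dual M)"
  have xM: "x \<in> mcarr M" "f x \<noteq> 0" and f: "f \<in> ?D"
    and xf: "\<And>g y. g \<in> ?D \<Longrightarrow> f x * g y = g x * f y"
    using x unfolding rank_one_at_def by blast+
  have sub: "fun_submodule ?D" unfolding mcarr_dual by (rule fun_submodule_semilinear)
  have D: "dual M = fun_mod ?D" by (simp add: dual_eq)
  have ev: "biduality M y \<in> mcarr (dual (dual M))" for y
    using eval_at_dual[OF sub, of y] by (simp add: biduality_eval_at dual_eq)
  have "rank_one (dual M)"
    unfolding rank_one_def
  proof (intro conjI ballI bexI[OF _ f] allI impI)
    fix r assume "msmult (dual M) r f = mzero (dual M)"
    then have "(\<lambda>y. r * f y) = (\<lambda>_. 0)" by (simp only: dual_eq fun_mod_simps)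
    then have "r * f x = 0" by (rule fun_cong)
    then show "r = 0" using xM by simp
  next
    fix g h assume g: "g \<in> ?D" and h: "h \<in> ?D"
    show "\<exists>r s. (r \<noteq> 0 \<or> s \<noteq> 0) \<and> msmult (dual M) r g = msmult (dual M) s h"
    \<comment> \<open>The natural coefficients \<open>h x\<close> and \<open>g x\<close> fail only
      if both vanish; then \<open>g = h\<close> and both coefficients can be 1.\<close>
    proof (cases "g x = 0 \<and> h x = 0")
      case True
      then have "g = h" using rank_one_at_determined[OF x g h] by simp
      then show ?thesis by (intro exI[of _ 1]) simp
    next
      case False
      have "(\<lambda>y. h x * g y) = (\<lambda>y. g x * h y)"
        by (rule rank_one_at_determined[OF x])
          (simp_all add: fun_submoduleD(3)[OF sub] g h)
      then have "msmult (dual M) (h x) g = msmult (dual M) (g x) h" by (simp add: dual_eq)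
      then show ?thesis using False by blast
    qed
  qed
  moreover have "bij_betw (biduality (dual M)) ?D (mcarr (bidual (dual M)))"
    unfolding bij_betw_def
  proof (intro conjI subset_antisym subsetI)
    show "inj_on (biduality (dual M)) ?D"
    proof (rule inj_onI)
      fix g h assume gh: "g \<in> ?D" "h \<in> ?D" "biduality (dual M) g = biduality (dual M) h"
      then have "biduality (dual M) g (biduality M x) = biduality (dual M) h (biduality M x)" by simp
      then have "g x = h x" using ev gh(1,2) by (simp add: biduality_def)
      then show "g = h" by (rule rank_one_at_determined[OF x gh(1,2)])
    qed
    fix \<Xi> assume "\<Xi> \<in> biduality (dual M) ` ?D"
    then obtain g where "\<Xi> = biduality (dual M) g" by blast
    moreover have "fun_submodule (mcarr (dual (dual M)))" unfolding mcarr_dual by (rule fun_submodule_semilinear)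
    ultimately show "\<Xi> \<in> mcarr (bidual (dual M))"
      using eval_at_dual[of "mcarr (dual (dual M))" g] by (simp add: biduality_eval_at bidual_def dual_eq)
  next
    fix \<Xi> assume "\<Xi> \<in> mcarr (bidual (dual M))"
    then have \<Xi>: "\<Xi> \<in> mcarr (dual (dual (dual M)))" by (simp add: bidual_def)
    \<comment> \<open>The pullback of \<Xi> along the biduality map of \<open>M\<close>.\<close>
    define g where "g y = (if y \<in> mcarr M then \<Xi> (biduality M y) else 0)" for y
    have g: "g \<in> ?D"
      unfolding mcarr_dual
    proof (rule semilinearI)
      fix y z assume yz: "y \<in> mcarr M" "z \<in> mcarr M"
      then have "biduality M (madd M y z) = madd (dual (dual M)) (biduality M y) (biduality M z)"
        by (auto simp: biduality_def dual_eq[of "dual M"] dual_mapD)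
      then show "g (madd M y z) = g y + g z"
        using yz is_moduleD(2)[OF M yz] dual_mapD(1)[OF \<Xi> ev ev] by (simp add: g_def)
    next
      fix r y assume y: "y \<in> mcarr M"
      then have "biduality M (msmult M r y) = msmult (dual (dual M)) r (biduality M y)"
        by (auto simp: biduality_def dual_eq[of "dual M"] dual_mapD)
      then show "g (msmult M r y) = r * g y"
        using y is_moduleD(3)[OF M y] dual_mapD(2)[OF \<Xi> ev] by (simp add: g_def)
    qed (simp add: g_def)
    have "biduality (dual M) g \<in> mcarr (dual (dual (dual M)))"
      using eval_at_dual[OF fun_submodule_semilinear[of "\<lambda>r. r" "dual M"], of g]
      by (simp add: biduality_eval_at dual_eq)
    moreover have "\<Xi> (biduality M x) = biduality (dual M) g (biduality M x)"
    proof -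
      have "biduality (dual M) g (biduality M x) = g x"
        using ev g by (simp add: biduality_def)
      then show ?thesis using xM by (simp add: g_def)
    qed
    ultimately have "\<Xi> = biduality (dual M) g"
      by (rule rank_one_at_determined[OF rank_one_at_dual[OF rank_one_at_dual[OF x]] \<Xi>])
    then show "\<Xi> \<in> biduality (dual M) ` ?D" using g by blast
  qed
  ultimately show ?thesis
    unfolding refl_rank_one_def reflexive_def using is_module_dual fin_gen_dual[OF noeth x] by blast
qed

section \<open>Reflexive modules of rank one at a prime\<close>

lemma localization_iff:
  assumes "prime_ideal q"
  shows "x \<in> localization q \<longleftrightarrow> (\<exists>a s. s \<notin> q \<and> to_fract s * x = to_fract a)"
proof -
  have "0 \<in> q" using assms by (simp add: prime_ideal_def is_ideal_def)
  then have nz: "s \<noteq> 0" if "s \<notin> q" for s using that by blast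
  have "x = Fraction_Field.Fract a s \<longleftrightarrow> to_fract s * x = to_fract a" if "s \<notin> q" for a s
    using nz[OF that] by (auto simp: Fract_conv_to_fract field_simps)
  then show ?thesis unfolding localization_def by blast
qed

lemma prime_ideal_mult: "prime_ideal q \<Longrightarrow> a \<notin> q \<Longrightarrow> b \<notin> q \<Longrightarrow> a * b \<notin> q"
  unfolding prime_ideal_def by blast

lemma one_notin_prime_ideal:
  assumes "prime_ideal q" shows "1 \<notin> q"
proof
  assume "1 \<in> q"
  then have "r * 1 \<in> q" for r using assms unfolding prime_ideal_def is_ideal_def by blast
  then show False using assms unfolding prime_ideal_def by auto
qed

lemma localization_mult:
  assumes q: "prime_ideal q" and "x \<in> localization q" "y \<in> localization q"
  shows "x * y \<in> localization q"
proof -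
  obtain a s b t where s: "s \<notin> q" "to_fract s * x = to_fract a" and t: "t \<notin> q" "to_fract t * y = to_fract b"
    using assms(2,3) unfolding localization_iff[OF q] by blast
  have "to_fract (s * t) * (x * y) = (to_fract s * x) * (to_fract t * y)" by (simp add: mult_ac)
  also have "\<dots> = to_fract (a * b)" by (simp add: s t)
  finally show ?thesis unfolding localization_iff[OF q] using prime_ideal_mult[OF q s(1) t(1)] by blast
qed

lemma to_fract_localization: "prime_ideal q \<Longrightarrow> to_fract a \<in> localization q"
  unfolding localization_iff
  by (intro exI[of _ a] exI[of _ 1]) (simp add: one_notin_prime_ideal)

lemma unit_in_localizationD:
  assumes q: "prime_ideal q" and "unit_in (localization q) (to_fract a)"
  shows "a \<notin> q"
proof
  assume "a \<in> q"
  obtain c where c: "c \<in> localization q" "1 = to_fract a * c"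
    using assms(2) unfolding unit_in_def dvd_in_def by blast
  then obtain b s where s: "s \<notin> q" "to_fract s * c = to_fract b"
    unfolding localization_iff[OF q] by blast
  have "to_fract s = to_fract s * (to_fract a * c)" using c(2) by simp
  also have "\<dots> = (to_fract s * c) * to_fract a" by (simp only: mult_ac)
  also have "\<dots> = to_fract (b * a)" by (simp only: s(2) to_fract_mult)
  finally have "to_fract s = to_fract (b * a)" .
  then have "s = b * a" by (rule to_fract_eq_iff[THEN iffD1])
  then show False using s(1) \<open>a \<in> q\<close> q unfolding prime_ideal_def is_ideal_def by blast
qed

lemma unit_in_localizationI:
  assumes q: "prime_ideal q" and "s \<notin> q"
  shows "unit_in (localization q) (to_fract s)"
proof -
  have "s \<noteq> 0" using assms unfolding prime_ideal_def is_ideal_def by blast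
  then have e: "to_fract s * (1 / to_fract s) = 1" by simp
  then have "1 / to_fract s \<in> localization q"
    unfolding localization_iff[OF q] using assms(2) by (intro exI[of _ 1] exI[of _ s]) simp
  then show ?thesis
    unfolding unit_in_def dvd_in_def using to_fract_localization[OF q] e[symmetric] by blast
qed

lemma unit_in_localization_mult:
  assumes q: "prime_ideal q" and "unit_in (localization q) u" "unit_in (localization q) v"
  shows "unit_in (localization q) (u * v)"
proof -
  obtain c d where c: "c \<in> localization q" "1 = u * c" and d: "d \<in> localization q" "1 = v * d"
    and uv: "u \<in> localization q" "v \<in> localization q"
    using assms(2,3) unfolding unit_in_def dvd_in_def by blast
  have "(u * v) * (c * d) = (u * c) * (v * d)" by (simp only: mult_ac)
  then have "1 = (u * v) * (c * d)" by (simp flip: c(2) d(2))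
  then show ?thesis unfolding unit_in_def dvd_in_def
    using localization_mult[OF q uv] localization_mult[OF q c(1) d(1)] by blast
qed

section \<open>Dividing forms at a prime\<close>

lemma lincomb_closed:
  assumes "is_module M" "\<And>x. x \<in> G \<Longrightarrow> x \<in> mcarr M" "mzero M \<in> G"
    and "\<And>x y. x \<in> G \<Longrightarrow> y \<in> G \<Longrightarrow> madd M x y \<in> G" "\<And>r x. x \<in> G \<Longrightarrow> msmult M r x \<in> G"
    and "snd ` set xs \<subseteq> G"
  shows "lincomb M xs \<in> G"
  using assms(6)
proof (induction xs)
  case (Cons rx xs)
  then show ?case using assms(4,5) by (cases rx) auto
qed (use assms(3) in simp)

lemma dual_mzero:
  assumes "is_module M" "f \<in> mcarr (dual M)"
  shows "f (mzero M) = 0"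
  using dual_mapD(1)[OF assms(2), of "mzero M" "mzero M"] is_moduleD(1,6)[OF assms(1)] by simp

text \<open>Finite generation provides one denominator \<open>s\<close> that serves every \<open>f x / p\<close>.\<close>

lemma dual_divide_locally:
  fixes M :: "('r::idom, 'm) rmod"
  assumes q: "prime_ideal q" and M: "is_module M" and fg: "fin_gen M" and f: "f \<in> mcarr (dual M)"
    and p: "p \<noteq> 0" and dvd: "\<And>x. x \<in> mcarr M \<Longrightarrow> dvd_in (localization q) p (to_fract (f x))"
  obtains s g where "s \<notin> q" "g \<in> mcarr (dual M)"
    "\<And>x. x \<in> mcarr M \<Longrightarrow> p * to_fract (g x) = to_fract s * to_fract (f x)"
proof -
  have "\<exists>s. s \<notin> q \<and> (\<forall>x\<in>set gs. \<exists>a. p * to_fract a = to_fract s * to_fract (f x))"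
    if "set gs \<subseteq> mcarr M" for gs
    using that
  proof (induction gs)
    case Nil then show ?case using one_notin_prime_ideal[OF q] by auto
  next
    case (Cons x gs)
    then obtain s where s: "s \<notin> q" "\<And>x. x \<in> set gs \<Longrightarrow> \<exists>a. p * to_fract a = to_fract s * to_fract (f x)"
      by auto
    obtain c where c: "c \<in> localization q" "to_fract (f x) = p * c"
      using dvd Cons.prems unfolding dvd_in_def by auto
    then obtain b t where t: "t \<notin> q" "to_fract t * c = to_fract b" unfolding localization_iff[OF q] by blast
    have "\<exists>a. p * to_fract a = to_fract (s * t) * to_fract (f y)" if y: "y \<in> set (x # gs)" for y
    proof (cases "y = x")
      case True
      have "to_fract (s * t) * to_fract (f x) = p * to_fract (s * b)"
        unfolding c(2) to_fract_mult t(2)[symmetric] by (simp add: mult_ac)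
      then show ?thesis using True by metis
    next
      case False
      then obtain a where "p * to_fract a = to_fract s * to_fract (f y)" using s(2) y by auto
      then have "p * to_fract (t * a) = to_fract (s * t) * to_fract (f y)" by (simp add: mult_ac)
      then show ?thesis by blast
    qed
    then show ?case using prime_ideal_mult[OF q s(1) t(1)] by blast
  qed
  moreover obtain gs where gs: "set gs \<subseteq> mcarr M"
    "\<And>x. x \<in> mcarr M \<Longrightarrow> \<exists>cs. length cs = length gs \<and> x = lincomb M (zip cs gs)"
    using fg unfolding fin_gen_def by blast
  ultimately obtain s where s: "s \<notin> q" "\<And>x. x \<in> set gs \<Longrightarrow> \<exists>a. p * to_fract a = to_fract s * to_fract (f x)"
    by blast
  \<comment> \<open>The elements on which \<open>s\<close> makes division by \<open>p\<close>
    possible form a submodule, so it is enough that the generators belong to it.\<close>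
  define G where "G = {x \<in> mcarr M. \<exists>a. p * to_fract a = to_fract s * to_fract (f x)}"
  note MD = is_moduleD[OF M] and fD = dual_mapD[OF f]
  have G: "lincomb M xs \<in> G" if "snd ` set xs \<subseteq> G" for xs
  proof (rule lincomb_closed[OF M _ _ _ _ that])
    show "mzero M \<in> G" using MD(1) dual_mzero[OF M f] by (auto simp: G_def intro: exI[of _ 0])
    fix x assume x: "x \<in> G"
    then show "x \<in> mcarr M" by (simp add: G_def)
    obtain a where a: "x \<in> mcarr M" "p * to_fract a = to_fract s * to_fract (f x)" using x by (auto simp: G_def)
    show "msmult M r x \<in> G" for r
    proof -
      have "p * to_fract (r * a) = to_fract s * to_fract (f (msmult M r x))"
        using a by (simp add: fD mult.left_commute)
      then show ?thesis using MD(3) a(1) unfolding G_def by blast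
    qed
    fix y assume "y \<in> G"
    then obtain b where b: "y \<in> mcarr M" "p * to_fract b = to_fract s * to_fract (f y)" by (auto simp: G_def)
    have "p * to_fract (a + b) = to_fract s * to_fract (f (madd M x y))"
      using a b by (simp add: fD distrib_left)
    then show "madd M x y \<in> G" using MD(2) a(1) b(1) unfolding G_def by blast
  qed
  have "x \<in> G" if x: "x \<in> mcarr M" for x
  proof -
    obtain cs where cs: "length cs = length gs" "x = lincomb M (zip cs gs)" using gs(2)[OF x] by blast
    have "snd ` set (zip cs gs) \<subseteq> G"
      using s(2) gs(1) by (auto simp: G_def dest: set_zip_rightD)
    then show ?thesis using G cs(2) by blast
  qed
  then have ex: "\<exists>a. p * to_fract a = to_fract s * to_fract (f x)" if "x \<in> mcarr M" for x
    using that by (auto simp: G_def)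
  \<comment> \<open>This is \<open>s f / p\<close>. As \<open>p \<noteq> 0\<close>, the chosen value
    is unique, which makes \<open>g\<close> linear.\<close>
  define g where "g x = (if x \<in> mcarr M then SOME a. p * to_fract a = to_fract s * to_fract (f x) else 0)" for x
  have g: "p * to_fract (g x) = to_fract s * to_fract (f x)" if "x \<in> mcarr M" for x
    using someI_ex[OF ex[OF that]] that by (simp add: g_def)
  have cancel: "a = b" if "p * to_fract a = p * to_fract b" for a b using that p by simp
  have "g \<in> mcarr (dual M)"
    unfolding mcarr_dual
  proof (rule semilinearI)
    fix x y assume xy: "x \<in> mcarr M" "y \<in> mcarr M"
    show "g (madd M x y) = g x + g y"
      by (rule cancel) (simp add: xy g MD(2) fD distrib_left)
  next
    fix r x assume x: "x \<in> mcarr M"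
    have "p * to_fract (r * g x) = to_fract r * (p * to_fract (g x))" by (simp add: mult_ac)
    then show "g (msmult M r x) = r * g x"
      by (intro cancel) (simp add: x g MD(3) fD mult_ac)
  qed (simp add: g_def)
  then show thesis using that s(1) g by blast
qed

text \<open>Two elements of a module of rank one are dependent, so the two-by-two determinant of
  their values under two forms vanishes.\<close>

lemma rank_one_dual_commute:
  assumes "rank_one M" "f \<in> mcarr (dual M)" "g \<in> mcarr (dual M)" "x \<in> mcarr M" "y \<in> mcarr M"
  shows "(f x * g y :: 'r::idom) = f y * g x"
proof -
  obtain r s where rs: "r \<noteq> 0 \<or> s \<noteq> 0" "msmult M r x = msmult M s y"
    using assms(1,4,5) unfolding rank_one_def by blast
  have f: "r * f x = s * f y" and g: "r * g x = s * g y"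
    using arg_cong[OF rs(2), of f] arg_cong[OF rs(2), of g]
    by (simp_all add: dual_mapD(2)[OF assms(2)] dual_mapD(2)[OF assms(3)] assms(4,5))
  show ?thesis
  proof (cases "r = 0")
    case False
    have "r * (f x * g y) = (r * f x) * g y" by (simp only: mult_ac)
    also have "\<dots> = f y * (r * g x)" by (simp only: f g mult_ac)
    also have "\<dots> = r * (f y * g x)" by (simp only: mult_ac)
    finally show ?thesis using False by simp
  next
    case True
    then have "f y = 0" "g y = 0" using f g rs(1) by auto
    then show ?thesis by simp
  qed
qed

text \<open>The last two facts are surjectivity and injectivity of biduality in terms of elements: a
  form on the dual is evaluation at a point, and forms separate points.\<close>

lemma refl_rank_oneD:
  assumes "refl_rank_one (M :: ('r::idom, 'm) rmod)"
  shows "is_module M" "fin_gen M" "rank_one M"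
    and "\<And>\<xi>. \<xi> \<in> mcarr (dual (dual M)) \<Longrightarrow> \<exists>x\<in>mcarr M. \<forall>f\<in>mcarr (dual M). \<xi> f = f x"
    and "\<And>x y. x \<in> mcarr M \<Longrightarrow> y \<in> mcarr M \<Longrightarrow> (\<And>f. f \<in> mcarr (dual M) \<Longrightarrow> f x = f y) \<Longrightarrow> x = y"
proof -
  have bij: "bij_betw (biduality M) (mcarr M) (mcarr (dual (dual M)))"
    and *: "is_module M" "fin_gen M" "rank_one M"
    using assms by (simp_all add: refl_rank_one_def reflexive_def bidual_def)
  show "is_module M" "fin_gen M" "rank_one M" by (fact *)+
  show "\<exists>x\<in>mcarr M. \<forall>f\<in>mcarr (dual M). \<xi> f = f x" if \<xi>: "\<xi> \<in> mcarr (dual (dual M))" for \<xi>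
  proof -
    have "\<xi> \<in> biduality M ` mcarr M" using bij_betw_imp_surj_on[OF bij] \<xi> by simp
    then obtain x where "x \<in> mcarr M" "\<xi> = biduality M x" by (rule imageE)
    then show ?thesis by (auto simp: biduality_def)
  qed
  show "x = y" if x: "x \<in> mcarr M" and y: "y \<in> mcarr M"
    and eq: "\<And>f. f \<in> mcarr (dual M) \<Longrightarrow> f x = f y" for x y
  proof (rule inj_onD[OF bij_betw_imp_inj_on[OF bij] _ x y])
    show "biduality M x = biduality M y" unfolding biduality_def by (rule ext) (simp add: eq)
  qed
qed

lemma refl_rank_one_nontrivial:
  assumes M: "refl_rank_one (M :: ('r::idom, 'm) rmod)"
  obtains f x where "f \<in> mcarr (dual M)" "x \<in> mcarr M" "f x \<noteq> 0"
proof -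
  note R = refl_rank_oneD[OF M] and MD = is_moduleD[OF refl_rank_oneD(1)[OF M]]
  obtain x where x: "x \<in> mcarr M" "\<And>r. msmult M r x = mzero M \<Longrightarrow> r = 0"
    using R(3) unfolding rank_one_def by blast
  have "x \<noteq> mzero M" using x(2)[of 1] MD(4)[OF x(1)] by auto
  then obtain f where "f \<in> mcarr (dual M)" "f x \<noteq> f (mzero M)" using R(5)[OF x(1) MD(1)] by blast
  then have "f x \<noteq> 0" using dual_mzero[OF R(1), of f] by simp
  with \<open>f \<in> mcarr (dual M)\<close> x(1) show thesis by (rule that)
qed

lemma refl_rank_one_rank_one_at:
  assumes "refl_rank_one M" "f \<in> mcarr (dual M)" "x \<in> mcarr M" "f x \<noteq> 0"
  shows "rank_one_at M x f"
  unfolding rank_one_at_def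
proof (intro conjI ballI allI)
  fix g y assume g: "g \<in> mcarr (dual M)"
  show "f x * g y = g x * f y"
  proof (cases "y \<in> mcarr M")
    case True
    then show ?thesis using rank_one_dual_commute[OF refl_rank_oneD(3)[OF assms(1)] assms(2) g assms(3)]
      by (simp add: mult.commute)
  next
    case False then show ?thesis using dual_mapD(3)[OF g] dual_mapD(3)[OF assms(2)] by simp
  qed
qed (use assms in auto)

text \<open>The equation \<open>y = (f y / f x) x\<close> without denominators. It holds because
  forms separate points, and being an identity in \<open>M\<close> it survives every semilinear map,
  even if \<open>phi\<close> has a kernel.\<close>

lemma refl_rank_one_smult:
  fixes M :: "('r::idom, 'm) rmod"
  assumes M: "refl_rank_one M" and f: "f \<in> mcarr (dual M)" and x: "x \<in> mcarr M" and y: "y \<in> mcarr M"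
  shows "msmult M (f x) y = msmult M (f y) x"
proof (rule refl_rank_oneD(5)[OF M])
  fix g assume g: "g \<in> mcarr (dual M)"
  show "g (msmult M (f x) y) = g (msmult M (f y) x)"
    using rank_one_dual_commute[OF refl_rank_oneD(3)[OF M] f g x y] dual_mapD(2)[OF g] x y by simp
qed (use is_moduleD(3)[OF refl_rank_oneD(1)[OF M]] x y in auto)

text \<open>Take \<open>f x\<close> with the fewest prime factors at \<open>q\<close>. A prime factor \<open>p\<close> can be divided out of
  \<open>f\<close> or, by reflexivity, out of \<open>x\<close>, unless it misses some \<open>f y\<close> and some \<open>g x\<close>; but
  \<open>p\<close> divides \<open>f x * g y = f y * g x\<close>.\<close>

lemma refl_rank_one_locally_free:
  fixes M :: "('r::idom, 'm) rmod"
  assumes noeth: "noetherian_ring TYPE('r)" and M: "refl_rank_one M"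
    and q: "prime_ideal q" and ufd: "ufd_subring (localization q)"
  shows "\<exists>f\<in>mcarr (dual M). \<exists>x\<in>mcarr M. f x \<notin> q"
proof -
  let ?S = "localization q" and ?D = "mcarr (dual M)"
  note R = refl_rank_oneD[OF M]
  define P where "P n \<longleftrightarrow> (\<exists>f x u ps. f \<in> ?D \<and> x \<in> mcarr M \<and> unit_in ?S u \<and> (\<forall>p\<in>set ps. prime_in ?S p) \<and>
    to_fract (f x) = u * prod_list ps \<and> length ps = n)" for n
  obtain f0 x0 where f0: "f0 \<in> ?D" "x0 \<in> mcarr M" "f0 x0 \<noteq> 0" using refl_rank_one_nontrivial[OF M] .
  have "\<exists>n. P n"
  \<comment> \<open>\<open>ufd_subring\<close> factors nonunits only; a unit is the case of no prime
    factors.\<close>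
  proof (cases "unit_in ?S (to_fract (f0 x0))")
    case True
    then have "P 0" unfolding P_def using f0 by (intro exI[of _ f0] exI[of _ x0] exI[of _ "to_fract (f0 x0)"]) simp
    then show ?thesis by blast
  next
    case False
    then obtain ps where ps: "\<forall>p\<in>set ps. prime_in ?S p" "to_fract (f0 x0) = prod_list ps"
      using ufd to_fract_localization[OF q] f0(3) unfolding ufd_subring_def by (metis to_fract_eq_0_iff)
    moreover have "unit_in ?S 1" using unit_in_localizationI[OF q one_notin_prime_ideal[OF q]] by simp
    ultimately have "P (length ps)" unfolding P_def using f0
      by (intro exI[of _ f0] exI[of _ x0] exI[of _ 1] exI[of _ ps]) simp
    then show ?thesis by blast
  qed
  then have least: "P (LEAST n. P n)" "\<And>n. P n \<Longrightarrow> (LEAST n. P n) \<le> n" by (auto intro: LeastI Least_le)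
  then obtain f x u ps where f: "f \<in> ?D" and x: "x \<in> mcarr M" and u: "unit_in ?S u"
    and ps: "\<forall>p\<in>set ps. prime_in ?S p" and fx: "to_fract (f x) = u * prod_list ps"
    and len: "length ps = (LEAST n. P n)"
    unfolding P_def by blast
  show ?thesis
  proof (cases ps)
    case Nil
    then have "f x \<notin> q" using unit_in_localizationD[OF q] u fx by simp
    then show ?thesis using f x by blast
  next
    case (Cons p ps')
    have p: "prime_in ?S p" and ps': "\<forall>p\<in>set ps'. prime_in ?S p" using ps Cons by auto
    then have p0: "p \<noteq> 0" and pS: "p \<in> ?S" by (auto simp: prime_in_def)
    \<comment> \<open>A value equal to \<open>f x / p\<close> up to a factor outside
      \<open>q\<close> has one prime factor fewer, since that factor is absorbed into the unit. This
      contradicts minimality.\<close>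
    have shorter: False if "g \<in> ?D" "y \<in> mcarr M" "s \<notin> q" "p * to_fract (g y) = to_fract s * to_fract (f x)" for g y s
    proof -
      have "p * to_fract (g y) = p * ((to_fract s * u) * prod_list ps')"
        unfolding that(4) fx Cons by (simp add: mult_ac)
      then have "to_fract (g y) = (to_fract s * u) * prod_list ps'" using p0 by (simp only: mult_cancel_left) simp
      moreover have "unit_in ?S (to_fract s * u)"
        by (rule unit_in_localization_mult[OF q unit_in_localizationI[OF q that(3)] u])
      ultimately have "P (length ps')" unfolding P_def using that(1,2) ps' by blast
      then show False using least(2) len Cons by fastforce
    qed
    have "prod_list ps' \<in> ?S"
      using ps' by (induction ps') (auto simp: prime_in_def localization_mult[OF q] simp flip: to_fract_1
        intro: to_fract_localization[OF q])
    then have "u * prod_list ps' \<in> ?S" using u localization_mult[OF q] unfolding unit_in_def by blast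
    moreover have "to_fract (f x) = p * (u * prod_list ps')" unfolding fx Cons by (simp add: mult_ac)
    ultimately have px: "dvd_in ?S p (to_fract (f x))" unfolding dvd_in_def by blast
    have "\<exists>y\<in>mcarr M. \<not> dvd_in ?S p (to_fract (f y))"
    proof (rule ccontr)
      assume "\<not> ?thesis"
      then have "\<And>y. y \<in> mcarr M \<Longrightarrow> dvd_in ?S p (to_fract (f y))" by blast
      from dual_divide_locally[OF q R(1,2) f p0 this] obtain s g
        where "s \<notin> q" "g \<in> ?D" "\<And>x. x \<in> mcarr M \<Longrightarrow> p * to_fract (g x) = to_fract s * to_fract (f x)" by blast
      then show False using shorter x by blast
    qed
    then obtain y where y: "y \<in> mcarr M" "\<not> dvd_in ?S p (to_fract (f y))" by blast
    have "\<exists>g\<in>?D. \<not> dvd_in ?S p (to_fract (g x))"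
    proof (rule ccontr)
      assume "\<not> ?thesis"
      then have dvd: "dvd_in ?S p (to_fract (biduality M x g))" if "g \<in> ?D" for g
        using that by (simp add: biduality_def)
      have fg: "fin_gen (dual M)"
        by (rule fin_gen_dual[OF noeth refl_rank_one_rank_one_at[OF M f0]])
      have ev: "biduality M x \<in> mcarr (dual (dual M))"
        using eval_at_dual[OF fun_submodule_semilinear] by (simp add: biduality_eval_at dual_eq)
      \<comment> \<open>Division is applied to evaluation at \<open>x\<close> on
        \<open>dual M\<close>. By reflexivity the quotient \<xi> is evaluation at some
        \<open>z\<close>, which plays the part of \<open>x / p\<close>.\<close>
      from dual_divide_locally[OF q is_module_dual fg ev p0 dvd] obtain s \<xi>
        where s: "s \<notin> q" and \<xi>: "\<xi> \<in> mcarr (dual (dual M))"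
          "\<And>g. g \<in> ?D \<Longrightarrow> p * to_fract (\<xi> g) = to_fract s * to_fract (biduality M x g)" by blast
      obtain z where z: "z \<in> mcarr M" "\<And>g. g \<in> ?D \<Longrightarrow> \<xi> g = g z" using R(4)[OF \<xi>(1)] by blast
      then show False using shorter[OF f z(1) s] \<xi>(2)[OF f] f by (simp add: biduality_def)
    qed
    then obtain g where g: "g \<in> ?D" "\<not> dvd_in ?S p (to_fract (g x))" by blast
    have "to_fract (f x) * to_fract (g y) = to_fract (f y) * to_fract (g x)"
      using rank_one_dual_commute[OF R(3) f g(1) x y(1)] by (simp flip: to_fract_mult)
    moreover have "dvd_in ?S p (to_fract (f x) * to_fract (g y))"
    proof -
      obtain c where "c \<in> ?S" "to_fract (f x) = p * c" using px unfolding dvd_in_def by blast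
      then have "c * to_fract (g y) \<in> ?S" "to_fract (f x) * to_fract (g y) = p * (c * to_fract (g y))"
        using localization_mult[OF q] to_fract_localization[OF q] by (auto simp: mult.assoc)
      then show ?thesis unfolding dvd_in_def by blast
    qed
    ultimately have "dvd_in ?S p (to_fract (f y)) \<or> dvd_in ?S p (to_fract (g x))"
      using p to_fract_localization[OF q] unfolding prime_in_def by simp
    then show ?thesis using y(2) g(2) by blast
  qed
qed

section \<open>Base change\<close>

lemma ring_hom_onD:
  assumes "ring_hom_on phi"
  shows "phi 1 = 1" "phi (x + y) = phi x + phi y" "phi (x * y) = phi x * phi y" "phi 0 = 0"
proof -
  show *: "phi 1 = 1" "phi (x + y) = phi x + phi y" "phi (x * y) = phi x * phi y" for x y
    using assms unfolding ring_hom_on_def by blast+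
  have "phi 0 + phi 0 = phi 0 + 0" using *(2)[of 0 0, symmetric] by (simp only: add_0_right)
  then show "phi 0 = 0" by (simp only: add_left_cancel)
qed

lemma prime_ideal_vimage:
  assumes hom: "ring_hom_on phi" and P: "prime_ideal P"
  shows "prime_ideal (phi -` P)"
proof -
  note h = ring_hom_onD[OF hom]
  have "is_ideal (phi -` P)" using P by (simp add: prime_ideal_def is_ideal_def h)
  moreover have "phi -` P \<noteq> UNIV"
  proof
    assume "phi -` P = UNIV"
    then have "1 \<in> phi -` P" by simp
    then show False using one_notin_prime_ideal[OF P] h(1) by simp
  qed
  ultimately show ?thesis using P h(3) unfolding prime_ideal_def by auto
qed

text \<open>At the zero ideal, the condition that \<open>phi (f x)\<close> lies outside the prime
  says that it is nonzero.\<close>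

lemma height_le_one_zero: "height_le_one {0 :: 'r::idom}"
proof -
  have "{0 :: 'r} \<noteq> UNIV" using one_neq_zero by blast
  then have "prime_ideal {0 :: 'r}" unfolding prime_ideal_def is_ideal_def by simp
  moreover have "\<not> Q \<subset> {0 :: 'r}" if "prime_ideal Q" for Q
    using that unfolding prime_ideal_def is_ideal_def by auto
  ultimately show ?thesis unfolding height_le_one_def by blast
qed

section \<open>Semilinear and bilinear forms on reflexive modules of rank one\<close>

lemma semilinear_transfer:
  fixes phi :: "'a::idom \<Rightarrow> 'b::idom"
  assumes hom: "ring_hom_on phi" and "refl_rank_one M" "f \<in> mcarr (dual M)" "h \<in> semilinear phi M" "x \<in> mcarr M"
  shows "phi (f x) * h y = phi (f y) * h x"
proof (cases "y \<in> mcarr M")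
  case True
  show ?thesis using arg_cong[OF refl_rank_one_smult[OF assms(2,3,5) True], of h]
    by (simp add: semilinearD(2)[OF assms(4)] assms(5) True)
next
  case False
  then show ?thesis using semilinearD(3)[OF assms(4)] dual_mapD(3)[OF assms(3)] by (simp add: ring_hom_onD[OF hom])
qed

text \<open>\<open>refl_rank_one_smult\<close> is used in both variables at once. This exchange rule
  determines a form from a single value.\<close>

lemma bilinear_transfer:
  fixes phi :: "'a::idom \<Rightarrow> 'b::idom"
  assumes hom: "ring_hom_on phi" and M: "refl_rank_one M" "f \<in> mcarr (dual M)"
    and N: "refl_rank_one N" "g \<in> mcarr (dual N)"
    and b: "b \<in> bilinear phi M N" and x: "x \<in> mcarr M" "x' \<in> mcarr M" and y: "y \<in> mcarr N" "y' \<in> mcarr N"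
  shows "phi (f x * g y) * b (x', y') = phi (f x' * g y') * b (x, y)"
proof -
  note MD = is_moduleD[OF refl_rank_oneD(1)[OF M(1)]]
  note bD = bilinearD[OF b]
  have "phi (f x * g y) * b (x', y') = b (msmult M (f x) x', msmult N (g y) y')"
    using x y by (simp add: bD MD ring_hom_onD[OF hom] mult_ac)
  also have "\<dots> = b (msmult M (f x') x, msmult N (g y') y)"
    by (simp only: refl_rank_one_smult[OF M x] refl_rank_one_smult[OF N y])
  also have "\<dots> = phi (f x' * g y') * b (x, y)"
    using x y by (simp add: bD MD ring_hom_onD[OF hom] mult_ac)
  finally show ?thesis .
qed

text \<open>The composite of \<open>phi\<close> with \<open>f\<close> is a nonzero reference form to
  which all semilinear forms are proportional.\<close>

lemma semilinear_rank_one_at: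
  fixes phi :: "'a::idom \<Rightarrow> 'b::idom"
  assumes hom: "ring_hom_on phi" and M: "refl_rank_one M"
    and f: "f \<in> mcarr (dual M)" and x: "x \<in> mcarr M" "phi (f x) \<noteq> 0"
  shows "rank_one_at (fun_mod (semilinear phi M)) (\<lambda>y. phi (f y)) (eval_at (semilinear phi M) x)"
proof (rule rank_one_at_fun_mod)
  show "(\<lambda>y. phi (f y)) \<in> semilinear phi M"
    by (rule semilinearI) (simp_all add: dual_mapD[OF f] ring_hom_onD[OF hom])
  show "phi (f x) * g y = g x * phi (f y)" if "g \<in> semilinear phi M" for g y
    using semilinear_transfer[OF hom M f that x(1)] by (simp add: mult.commute)
qed (use fun_submodule_semilinear x(2) in auto)

lemma cl_map_iso:
  assumes "is_module M"
  shows "mod_iso (cl_map phi M) (dual (fun_mod (semilinear phi M)))"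
  unfolding cl_map_def bidual_def
  by (rule dual_iso[OF is_module_dual is_module_fun_mod[OF fun_submodule_semilinear] dual_base_change[OF assms]])

lemma is_module_cl_map: "is_module (cl_map phi M)"
  unfolding cl_map_def bidual_def by (rule is_module_dual)

text \<open>The class is the dual of the dual of the base change, so
  \<open>refl_rank_one_dual\<close> asks for nothing but a rank one witness on that first dual,
  transported from semilinear forms. Torsion in the base change does no harm.\<close>

lemma refl_rank_one_cl_map:
  fixes phi :: "'a::idom \<Rightarrow> 'b::idom"
  assumes hom: "ring_hom_on phi" and noethB: "noetherian_ring TYPE('b)" and M: "refl_rank_one M"
    and f: "f \<in> mcarr (dual M)" "x \<in> mcarr M" "phi (f x) \<noteq> 0"
  shows "refl_rank_one (cl_map phi M)"
proof -
  note S = is_module_fun_mod[OF fun_submodule_semilinear[of phi M]]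
  have "mod_iso (fun_mod (semilinear phi M)) (dual (base_change phi M))"
    by (rule mod_iso_sym[OF is_module_dual dual_base_change[OF refl_rank_oneD(1)[OF M]]])
  from rank_one_at_iso[OF S is_module_dual this semilinear_rank_one_at[OF hom M f]]
  obtain h \<xi> where "rank_one_at (dual (base_change phi M)) h \<xi>" .
  then show ?thesis unfolding cl_map_def bidual_def by (rule refl_rank_one_dual[OF noethB is_module_dual])
qed

lemma mod_iso_cl_map:
  assumes "is_module M" "is_module M'" "mod_iso M M'"
  shows "mod_iso (cl_map phi M) (cl_map phi M')"
proof -
  note S = is_module_fun_mod[OF fun_submodule_semilinear]
  have "mod_iso (cl_map phi M) (dual (fun_mod (semilinear phi M)))" by (rule cl_map_iso[OF assms(1)])
  also have "mod_iso \<dots> (dual (fun_mod (semilinear phi M')))"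
    by (rule dual_iso[OF S S semilinear_iso[OF assms]])
  also have "mod_iso \<dots> (cl_map phi M')"
    by (rule mod_iso_sym[OF is_module_cl_map cl_map_iso[OF assms(2)]])
  finally show ?thesis .
qed

section \<open>The two sides of the product formula\<close>

text \<open>On \<open>T = (M \<otimes> N)\<^sup>*\<^sup>*\<close> a form \<open>b\<close> has a unique extension with values in the fraction field of
  the target ring, computed from any \<open>f, x, g, y\<close> with \<open>phi (f x * g y) \<noteq> 0\<close>. Choosing them with
  \<open>phi (f x * g y) \<notin> P\<close> shows that no prime \<open>P\<close> of height at most one contains all denominators of a value.\<close>

lemma semilinear_bidual_tensor:
  fixes phi :: "'a::idom \<Rightarrow> 'b::idom" and M :: "('a, 'm) rmod" and N :: "('a, 'n) rmod"
  defines "B \<equiv> bilinear (\<lambda>r. r) M N"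
  defines "T \<equiv> dual (fun_mod B)"
  assumes hom: "ring_hom_on phi" and noethB: "noetherian_ring TYPE('b)" and normB: "normal_domain TYPE('b)"
    and M: "refl_rank_one M" and N: "refl_rank_one N"
    and freeM: "\<And>P. height_le_one P \<Longrightarrow> \<exists>f\<in>mcarr (dual M). \<exists>x\<in>mcarr M. phi (f x) \<notin> P"
    and freeN: "\<And>P. height_le_one P \<Longrightarrow> \<exists>g\<in>mcarr (dual N). \<exists>y\<in>mcarr N. phi (g y) \<notin> P"
  shows "mod_iso (fun_mod (semilinear phi T)) (fun_mod (bilinear phi M N))"
proof -
  note MD = is_moduleD[OF refl_rank_oneD(1)[OF M]] and ND = is_moduleD[OF refl_rank_oneD(1)[OF N]]
  have B: "fun_submodule B" unfolding B_def by (rule fun_submodule_bilinear)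
  have BD: "\<And>b. b \<in> B \<Longrightarrow> b \<in> bilinear (\<lambda>r. r) M N" by (simp add: B_def)
  have TD: "\<And>t. t \<in> mcarr T \<Longrightarrow> t \<in> mcarr (dual (fun_mod B))" by (simp add: T_def)
  have T: "madd T s t = (\<lambda>x. s x + t x)" "msmult T r t = (\<lambda>x. r * t x)" for r s t
    by (simp_all add: T_def dual_eq)
  have ev: "eval_at B z \<in> mcarr T" for z unfolding T_def by (rule eval_at_dual[OF B])
  let ?e = "\<lambda>x y. eval_at B (x, y)"
  have ev_add: "?e (madd M x x') y = madd T (?e x y) (?e x' y)"
    if "x \<in> mcarr M" "x' \<in> mcarr M" "y \<in> mcarr N" for x x' y
    using that by (auto simp: eval_at_def T bilinearD[OF BD])
  have ev_add': "?e x (madd N y y') = madd T (?e x y) (?e x y')"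
    if "x \<in> mcarr M" "y \<in> mcarr N" "y' \<in> mcarr N" for x y y'
    using that by (auto simp: eval_at_def T bilinearD[OF BD])
  have ev_smult: "?e (msmult M r x) y = msmult T r (?e x y)" "?e x (msmult N r y) = msmult T r (?e x y)"
    if "x \<in> mcarr M" "y \<in> mcarr N" for r x y
    using that by (auto simp: eval_at_def T bilinearD[OF BD])
  \<comment> \<open>The product form of \<open>f\<close> and \<open>g\<close> is the reference
    element of \<open>B\<close>, as \<open>f\<close> is in the dual of \<open>M\<close>.\<close>
  define prd where "prd f g = (\<lambda>(x, y). f x * g y)" for f :: "'m \<Rightarrow> 'a" and g :: "'n \<Rightarrow> 'a"
  have prd: "prd f g \<in> B" if "f \<in> mcarr (dual M)" "g \<in> mcarr (dual N)" for f g
    unfolding B_def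
    by (rule bilinearI)
      (auto simp: prd_def dual_mapD[OF that(1)] dual_mapD[OF that(2)] algebra_simps)
  have hom_id: "ring_hom_on (\<lambda>r::'a. r)" by (simp add: ring_hom_on_def)
  \<comment> \<open>Apply \<open>t\<close> to the identity
    \<open>f x * g y * b = b (x, y) * prd f g\<close> between forms.\<close>
  have t_rel: "f x * g y * t b = t (prd f g) * b (x, y)"
    if f: "f \<in> mcarr (dual M)" "x \<in> mcarr M" and g: "g \<in> mcarr (dual N)" "y \<in> mcarr N"
      and t: "t \<in> mcarr T" and b: "b \<in> B" for f x g y t b
  proof -
    have "(\<lambda>z. f x * g y * b z) = (\<lambda>z. b (x, y) * prd f g z)"
    proof
      fix z
      show "f x * g y * b z = b (x, y) * prd f g z"
      proof (cases z)
        case (Pair x' y')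
        show ?thesis
        proof (cases "x' \<in> mcarr M \<and> y' \<in> mcarr N")
          case True
          have "f x * g y * b (x', y') = f x' * g y' * b (x, y)"
            using bilinear_transfer[OF hom_id M f(1) N g(1) BD[OF b] f(2) conjunct1[OF True] g(2) conjunct2[OF True]] .
          then show ?thesis using Pair by (simp add: prd_def mult_ac)
        next
          case False
          then show ?thesis
            using Pair bilinearD(5,6)[OF BD[OF b]] dual_mapD(3)[OF f(1)] dual_mapD(3)[OF g(1)]
            by (auto simp: prd_def)
        qed
      qed
    qed
    then have "t (\<lambda>z. f x * g y * b z) = t (\<lambda>z. b (x, y) * prd f g z)" by simp
    then show ?thesis
      using dual_mapD(2)[OF TD[OF t], of b "f x * g y"] dual_mapD(2)[OF TD[OF t], of "prd f g" "b (x, y)"]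
        b prd[OF f(1) g(1)] by (simp add: mult.commute)
  qed
  \<comment> \<open>Over the fraction field, \<open>t\<close> is a multiple of the elementary tensor
    of \<open>x\<close> and \<open>y\<close>; this is that statement with denominators
    cleared.\<close>
  have t_ev: "msmult T (f x * g y) t = msmult T (t (prd f g)) (?e x y)"
    if f: "f \<in> mcarr (dual M)" "x \<in> mcarr M" and g: "g \<in> mcarr (dual N)" "y \<in> mcarr N"
      and t: "t \<in> mcarr T" for f x g y t
  proof
    fix b
    show "msmult T (f x * g y) t b = msmult T (t (prd f g)) (?e x y) b"
      using t_rel[OF that] dual_mapD(3)[OF TD[OF t], of b] by (cases "b \<in> B") (auto simp: T eval_at_def)
  qed
  obtain f x g y where f: "f \<in> mcarr (dual M)" "x \<in> mcarr M" "phi (f x) \<noteq> 0"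
    and g: "g \<in> mcarr (dual N)" "y \<in> mcarr N" "phi (g y) \<noteq> 0"
    using freeM[OF height_le_one_zero] freeN[OF height_le_one_zero] unfolding singleton_iff by blast
  let ?s = "phi (f x * g y)"
  have s0: "?s \<noteq> 0" using f(3) g(3) by (simp add: ring_hom_onD[OF hom])
  \<comment> \<open>The value of \<open>h\<close> on one elementary tensor determines
    \<open>h\<close>; this is injectivity of the restriction \<open>F\<close> below.\<close>
  have h_ev: "?s * h t = phi (t (prd f g)) * h (?e x y)" if h: "h \<in> semilinear phi T" and t: "t \<in> mcarr T" for h t
    using arg_cong[OF t_ev[OF f(1,2) g(1,2) t], of h] semilinearD(2)[OF h] t ev by simp
  define F where "F h = (\<lambda>(x, y). if x \<in> mcarr M \<and> y \<in> mcarr N then h (?e x y) else 0)" for h :: "_ \<Rightarrow> 'b"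
  show ?thesis
  proof (rule fun_mod_isoI[where F = F])
    fix h assume h: "h \<in> semilinear phi T"
    show "F h \<in> bilinear phi M N"
      by (rule bilinearI)
        (auto simp: F_def MD ND ev_add ev_add' ev_smult semilinearD(1,2)[OF h] ev)
  next
    fix h k assume h: "h \<in> semilinear phi T" and k: "k \<in> semilinear phi T" and eq: "F h = F k"
    show "h = k"
    proof (rule semilinear_eqI[OF h k])
      fix t assume t: "t \<in> mcarr T"
      have "h (?e x y) = k (?e x y)" using fun_cong[OF eq, of "(x, y)"] f(2) g(2) by (simp add: F_def)
      then have "?s * h t = ?s * k t" using h_ev[OF h t] h_ev[OF k t] by simp
      then show "h t = k t" using s0 by simp
    qed
  next
    fix b assume b: "b \<in> bilinear phi M N"
    note tr = bilinear_transfer[OF hom M _ N _ b]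
    \<comment> \<open>By \<open>h_ev\<close> an extension of \<open>b\<close> must take the value
      \<open>phi (t (prd f g)) * b (x, y) / ?s\<close> at \<open>t\<close>. It remains to see that
      this fraction lies in the target ring.\<close>
    have "?s dvd phi (t (prd f g)) * b (x, y)" if t: "t \<in> mcarr T" for t
    proof (rule normal_noetherian_dvd_local[OF noethB normB s0])
      fix P :: "'b set" assume P: "height_le_one P"
      obtain f' x' g' y' where f': "f' \<in> mcarr (dual M)" "x' \<in> mcarr M" "phi (f' x') \<notin> P"
        and g': "g' \<in> mcarr (dual N)" "y' \<in> mcarr N" "phi (g' y') \<notin> P"
        using freeM[OF P] freeN[OF P] by blast
      have "prime_ideal P" using P by (simp add: height_le_one_def)
      then have nP: "phi (f' x' * g' y') \<notin> P" using prime_ideal_mult f'(3) g'(3) by (simp add: ring_hom_onD[OF hom])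
      \<comment> \<open>Two exchanges: \<open>b\<close> trades \<open>x, y\<close> for
        \<open>x', y'\<close>, then \<open>t\<close> trades \<open>f, g\<close> for
        \<open>f', g'\<close>. The factor \<open>?s\<close> appears, multiplied by an element of the
        ring.\<close>
      have "phi (f' x' * g' y') * (phi (t (prd f g)) * b (x, y))
          = phi (t (prd f g)) * (phi (f' x' * g' y') * b (x, y))" by (simp only: mult_ac)
      also have "\<dots> = phi (t (prd f g)) * (phi (f' x * g' y) * b (x', y'))"
        by (simp only: tr[OF f'(1) g'(1) f'(2) f(2) g'(2) g(2)])
      also have "\<dots> = phi (t (prd f g) * prd f' g' (x, y)) * b (x', y')"
        by (simp add: prd_def ring_hom_onD[OF hom] mult_ac)
      also have "\<dots> = phi (f x * g y * t (prd f' g')) * b (x', y')"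
        by (simp only: t_rel[OF f(1,2) g(1,2) t prd[OF f'(1) g'(1)]])
      also have "\<dots> = ?s * (phi (t (prd f' g')) * b (x', y'))" by (simp add: ring_hom_onD[OF hom] mult_ac)
      finally show "\<exists>s. s \<notin> P \<and> ?s dvd s * (phi (t (prd f g)) * b (x, y))"
        using nP dvd_triv_left[of ?s "phi (t (prd f' g')) * b (x', y')"] by (intro exI[of _ "phi (f' x' * g' y')"]) simp
    qed
    then have ex: "\<exists>c. phi (t (prd f g)) * b (x, y) = ?s * c" if "t \<in> mcarr T" for t
      using that unfolding dvd_def by blast
    define h where "h t = (if t \<in> mcarr T then SOME c. phi (t (prd f g)) * b (x, y) = ?s * c else 0)" for t
    have h: "?s * h t = phi (t (prd f g)) * b (x, y)" if "t \<in> mcarr T" for t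
      using someI_ex[OF ex[OF that]] that by (simp add: h_def)
    have cancel: "c = d" if "?s * c = ?s * d" for c d using that s0 by simp
    have Tmod: "is_module T" unfolding T_def by (rule is_module_dual)
    have hs: "h \<in> semilinear phi T"
    proof (rule semilinearI)
      fix t u assume t: "t \<in> mcarr T" and u: "u \<in> mcarr T"
      then have tu: "madd T t u \<in> mcarr T" by (rule is_moduleD(2)[OF Tmod])
      show "h (madd T t u) = h t + h u"
        by (rule cancel) (simp add: h[OF tu] distrib_left h[OF t] h[OF u], simp add: T ring_hom_onD[OF hom] distrib_right)
    next
      fix r t assume t: "t \<in> mcarr T"
      then have rt: "msmult T r t \<in> mcarr T" by (rule is_moduleD(3)[OF Tmod])
      have "?s * (phi r * h t) = phi r * (?s * h t)" by (simp only: mult_ac)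
      also have "\<dots> = ?s * h (msmult T r t)"
        unfolding h[OF rt] h[OF t] by (simp add: T ring_hom_onD[OF hom] mult_ac)
      finally show "h (msmult T r t) = phi r * h t" by (rule cancel[OF sym])
    qed (simp add: h_def)
    have "F h = b"
    proof (rule bilinear_eqI[OF _ b])
      show "F h \<in> bilinear phi M N"
        by (rule bilinearI)
          (auto simp: F_def MD ND ev_add ev_add' ev_smult semilinearD(1,2)[OF hs] ev)
      fix x' y' assume x': "x' \<in> mcarr M" and y': "y' \<in> mcarr N"
      have "?s * h (?e x' y') = phi (f x' * g y') * b (x, y)"
        using h[OF ev] prd[OF f(1) g(1)] by (simp add: eval_at_def prd_def)
      also have "\<dots> = ?s * b (x', y')" by (rule tr[OF f(1) g(1) f(2) x' g(2) y', symmetric])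
      finally have "h (?e x' y') = b (x', y')" by (rule cancel)
      then show "F h (x', y') = b (x', y')" using x' y' by (simp add: F_def)
    qed
    then show "\<exists>h\<in>semilinear phi T. F h = b" using hs by (rule bexI)
  qed (auto simp: F_def)
qed

text \<open>Restriction along the evaluation maps of \<open>M\<close> and \<open>N\<close>. Here the
  inverse is explicit and needs no local argument: a slice of \<open>b\<close> is itself a
  semilinear form, to which elements of the duals can be applied one variable at a time.\<close>

lemma bilinear_dual_semilinear:
  fixes phi :: "'a::idom \<Rightarrow> 'b::idom" and M :: "('a, 'm) rmod" and N :: "('a, 'n) rmod"
  assumes hom: "ring_hom_on phi" and M: "refl_rank_one M" and N: "refl_rank_one N"
    and f: "f \<in> mcarr (dual M)" "x0 \<in> mcarr M" "phi (f x0) \<noteq> 0"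
    and g: "g \<in> mcarr (dual N)" "y0 \<in> mcarr N" "phi (g y0) \<noteq> 0"
  shows "mod_iso (fun_mod (bilinear (\<lambda>r. r) (dual (fun_mod (semilinear phi M))) (dual (fun_mod (semilinear phi N)))))
    (fun_mod (bilinear phi M N))"
proof -
  let ?C = "semilinear phi M" and ?D = "semilinear phi N"
  let ?X = "dual (fun_mod ?C)" and ?Y = "dual (fun_mod ?D)"
  note MD = is_moduleD[OF refl_rank_oneD(1)[OF M]] and ND = is_moduleD[OF refl_rank_oneD(1)[OF N]]
  have ops: "madd ?X s t = (\<lambda>x. s x + t x)" "msmult ?X r t = (\<lambda>x. r * t x)" for r s t by (simp_all add: dual_eq)
  have ops': "madd ?Y s t = (\<lambda>x. s x + t x)" "msmult ?Y r t = (\<lambda>x. r * t x)" for r s t by (simp_all add: dual_eq)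
  have ev: "eval_at ?C x \<in> mcarr ?X" for x by (rule eval_at_dual[OF fun_submodule_semilinear])
  have ev': "eval_at ?D y \<in> mcarr ?Y" for y by (rule eval_at_dual[OF fun_submodule_semilinear])
  have ev_lin: "eval_at ?C (madd M x x') = madd ?X (eval_at ?C x) (eval_at ?C x')"
    if "x \<in> mcarr M" "x' \<in> mcarr M" for x x'
    using that by (auto simp: eval_at_def ops semilinearD)
  have ev_lin': "eval_at ?D (madd N y y') = madd ?Y (eval_at ?D y) (eval_at ?D y')"
    if "y \<in> mcarr N" "y' \<in> mcarr N" for y y'
    using that by (auto simp: eval_at_def ops' semilinearD)
  have ev_smult: "eval_at ?C (msmult M r x) = msmult ?X (phi r) (eval_at ?C x)" if "x \<in> mcarr M" for r x
    using that by (auto simp: eval_at_def ops semilinearD)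
  have ev_smult': "eval_at ?D (msmult N r y) = msmult ?Y (phi r) (eval_at ?D y)" if "y \<in> mcarr N" for r y
    using that by (auto simp: eval_at_def ops' semilinearD)
  have phif: "(\<lambda>y. phi (f y)) \<in> ?C" and phig: "(\<lambda>y. phi (g y)) \<in> ?D"
    by (rule semilinearI; simp add: dual_mapD[OF f(1)] dual_mapD[OF g(1)] ring_hom_onD[OF hom])+
  have rel: "msmult ?X (phi (f x0)) \<xi> = msmult ?X (\<xi> (\<lambda>y. phi (f y))) (eval_at ?C x0)" if \<xi>: "\<xi> \<in> mcarr ?X" for \<xi>
    using semilinear_rank_one_at[OF hom M f] \<xi> unfolding rank_one_at_def
    by (auto simp: ops fun_eq_iff eval_at_def phif)
  have rel': "msmult ?Y (phi (g y0)) \<eta> = msmult ?Y (\<eta> (\<lambda>y. phi (g y))) (eval_at ?D y0)" if \<eta>: "\<eta> \<in> mcarr ?Y" for \<eta>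
    using semilinear_rank_one_at[OF hom N g] \<eta> unfolding rank_one_at_def
    by (auto simp: ops' fun_eq_iff eval_at_def phig)
  define F where "F b = (\<lambda>(x, y). if x \<in> mcarr M \<and> y \<in> mcarr N then b (eval_at ?C x, eval_at ?D y) else 0)"
    for b :: "_ \<Rightarrow> 'b"
  show ?thesis
  proof (rule fun_mod_isoI[where F = F])
    fix b assume b: "b \<in> bilinear (\<lambda>r. r) ?X ?Y"
    show "F b \<in> bilinear phi M N"
      by (rule bilinearI)
        (auto simp: F_def MD ND ev_lin ev_lin' ev_smult ev_smult' bilinearD(1-4)[OF b] ev ev')
  next
    fix b c assume b: "b \<in> bilinear (\<lambda>r. r) ?X ?Y" and c: "c \<in> bilinear (\<lambda>r. r) ?X ?Y" and eq: "F b = F c"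
    show "b = c"
    proof (rule bilinear_eqI[OF b c])
      fix \<xi> \<eta> assume \<xi>: "\<xi> \<in> mcarr ?X" and \<eta>: "\<eta> \<in> mcarr ?Y"
      \<comment> \<open>Multiplying by the two nonzero reference values moves both arguments to
        evaluations at \<open>x0\<close> and \<open>y0\<close>, where \<open>F b = F c\<close>
        applies.\<close>
      have expand: "phi (f x0) * (phi (g y0) * d (\<xi>, \<eta>))
          = \<xi> (\<lambda>y. phi (f y)) * (\<eta> (\<lambda>y. phi (g y)) * d (eval_at ?C x0, eval_at ?D y0))"
        if d: "d \<in> bilinear (\<lambda>r. r) ?X ?Y" for d
      proof -
        have smult: "d (msmult ?X r \<xi>', msmult ?Y s \<eta>') = r * (s * d (\<xi>', \<eta>'))"
          if "\<xi>' \<in> mcarr ?X" "\<eta>' \<in> mcarr ?Y" for r s \<xi>' \<eta>'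
          by (simp only: bilinearD(3)[OF d that(1) is_moduleD(3)[OF is_module_dual that(2)]] bilinearD(4)[OF d that])
        show ?thesis
          using smult[OF \<xi> \<eta>, of "phi (f x0)" "phi (g y0)"] unfolding rel[OF \<xi>] rel'[OF \<eta>] smult[OF ev ev'] by simp
      qed
      have "b (eval_at ?C x0, eval_at ?D y0) = c (eval_at ?C x0, eval_at ?D y0)"
        using fun_cong[OF eq, of "(x0, y0)"] f(2) g(2) by (simp add: F_def)
      then have "phi (f x0) * (phi (g y0) * b (\<xi>, \<eta>)) = phi (f x0) * (phi (g y0) * c (\<xi>, \<eta>))"
        using expand[OF b] expand[OF c] by simp
      then show "b (\<xi>, \<eta>) = c (\<xi>, \<eta>)" using f(3) g(3) by simp
    qed
  next
    fix b assume b: "b \<in> bilinear phi M N"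
    note bD = bilinearD[OF b]
    define slice where "slice y = (\<lambda>x. b (x, y))" for y
    have slice: "slice y \<in> ?C" for y
    proof (cases "y \<in> mcarr N")
      case True
      then show ?thesis by (intro semilinearI) (simp_all add: slice_def bD)
    next
      case False
      then show ?thesis by (intro semilinearI) (simp_all add: slice_def bD)
    qed
    have slice_add: "slice (madd N y y') = (\<lambda>x. slice y x + slice y' x)" if "y \<in> mcarr N" "y' \<in> mcarr N" for y y'
    proof
      show "slice (madd N y y') x = slice y x + slice y' x" for x
        using that by (cases "x \<in> mcarr M") (simp_all add: slice_def bD(2,5))
    qed
    have slice_smult: "slice (msmult N r y) = (\<lambda>x. phi r * slice y x)" if "y \<in> mcarr N" for r y
    proof
      show "slice (msmult N r y) x = phi r * slice y x" for x
        using that by (cases "x \<in> mcarr M") (simp_all add: slice_def bD(4,5))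
    qed
    have slice0: "slice y = (\<lambda>_. 0)" if "y \<notin> mcarr N" for y using that by (simp add: slice_def bD(6))
    \<comment> \<open>Applying \<xi> in the first variable leaves a semilinear form in the second,
      so some \<eta> can be applied to it.\<close>
    have outer: "(\<lambda>y. \<xi> (slice y)) \<in> ?D" if \<xi>: "\<xi> \<in> mcarr ?X" for \<xi>
    proof (rule semilinearI)
      fix y assume "y \<notin> mcarr N"
      then show "\<xi> (slice y) = 0"
        using dual_mzero[OF is_module_fun_mod[OF fun_submodule_semilinear] \<xi>] slice0 by simp
    qed (use dual_mapD(1,2)[OF \<xi>] slice in \<open>simp_all add: slice_add slice_smult\<close>)
    define c where "c = (\<lambda>(\<xi>, \<eta>). if \<xi> \<in> mcarr ?X \<and> \<eta> \<in> mcarr ?Y then \<eta> (\<lambda>y. \<xi> (slice y)) else 0)"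
    have c: "c \<in> bilinear (\<lambda>r. r) ?X ?Y"
    proof (rule bilinearI)
      fix \<xi> \<xi>' \<eta> assume \<xi>: "\<xi> \<in> mcarr ?X" "\<xi>' \<in> mcarr ?X" and \<eta>: "\<eta> \<in> mcarr ?Y"
      show "c (madd ?X \<xi> \<xi>', \<eta>) = c (\<xi>, \<eta>) + c (\<xi>', \<eta>)"
        using dual_mapD(1)[OF \<eta>, of "\<lambda>y. \<xi> (slice y)" "\<lambda>y. \<xi>' (slice y)"] \<xi> \<eta> outer
          is_moduleD(2)[OF is_module_dual \<xi>] by (simp add: c_def ops)
    next
      fix r \<xi> \<eta> assume \<xi>: "\<xi> \<in> mcarr ?X" and \<eta>: "\<eta> \<in> mcarr ?Y"
      show "c (msmult ?X r \<xi>, \<eta>) = r * c (\<xi>, \<eta>)"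
        using dual_mapD(2)[OF \<eta>, of "\<lambda>y. \<xi> (slice y)" r] \<xi> \<eta> outer
          is_moduleD(3)[OF is_module_dual \<xi>] by (simp add: c_def ops)
      show "c (\<xi>, msmult ?Y r \<eta>) = r * c (\<xi>, \<eta>)"
        using \<xi> \<eta> is_moduleD(3)[OF is_module_dual \<eta>] by (simp add: c_def ops')
      fix \<eta>' assume \<eta>': "\<eta>' \<in> mcarr ?Y"
      show "c (\<xi>, madd ?Y \<eta> \<eta>') = c (\<xi>, \<eta>) + c (\<xi>, \<eta>')"
        using \<xi> \<eta> \<eta>' is_moduleD(2)[OF is_module_dual \<eta> \<eta>'] by (simp add: c_def ops')
    qed (auto simp: c_def)
    have "F c (x, y) = b (x, y)" for x y
    proof (cases "x \<in> mcarr M \<and> y \<in> mcarr N")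
      case True
      have "(\<lambda>y. eval_at ?C x (slice y)) = (\<lambda>y. b (x, y))" using slice by (simp add: eval_at_def slice_def)
      moreover have "(\<lambda>y. b (x, y)) \<in> ?D" using True by (intro semilinearI) (simp_all add: bD)
      ultimately show ?thesis using True ev ev' by (simp add: F_def c_def) (simp add: eval_at_def)
    next
      case False then show ?thesis using bD(5,6) by (auto simp: F_def)
    qed
    then have "F c = b" by (auto simp: fun_eq_iff)
    then show "\<exists>c\<in>bilinear (\<lambda>r. r) ?X ?Y. F c = b" using c by (rule bexI)
  qed (auto simp: F_def fun_eq_iff)
qed

text \<open>A product-preserving map between groups preserves identity and inverses, so
  multiplicativity completes the claim. The carrier types \<open>'m\<close> and \<open>'n\<close>
  differ because an isomorphism class is not bound to one type.\<close>

theorem theorem1p10: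
  fixes phi :: "'a::idom \<Rightarrow> 'b::idom"
  assumes hom: "ring_hom_on phi"
    and noethA: "noetherian_ring TYPE('a)" and normA: "normal_domain TYPE('a)"
    and noethB: "noetherian_ring TYPE('b)" and normB: "normal_domain TYPE('b)"
    and ufd: "\<And>P::'b set. height_le_one P \<Longrightarrow> ufd_subring (localization (phi -` P))"
  shows "(\<forall>M::('a, 'm) rmod. refl_rank_one M \<longrightarrow> refl_rank_one (cl_map phi M))
    \<and> (\<forall>(M::('a, 'm) rmod) (M'::('a, 'n) rmod). refl_rank_one M \<and> refl_rank_one M' \<and> mod_iso M M'
          \<longrightarrow> mod_iso (cl_map phi M) (cl_map phi M'))
    \<and> (\<forall>(M::('a, 'm) rmod) (N::('a, 'n) rmod). refl_rank_one M \<and> refl_rank_one N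
          \<longrightarrow> mod_iso (cl_map phi (bidual (tensor M N)))
                      (bidual (tensor (cl_map phi M) (cl_map phi N))))"
proof -
  have free: "\<exists>f\<in>mcarr (dual M). \<exists>x\<in>mcarr M. phi (f x) \<notin> P"
    if M: "refl_rank_one M" and P: "height_le_one P" for M :: "('a, 'x) rmod" and P
  proof -
    have "prime_ideal (phi -` P)" using prime_ideal_vimage[OF hom] P by (simp add: height_le_one_def)
    then show ?thesis using refl_rank_one_locally_free[OF noethA M _ ufd[OF P]] by simp
  qed
  have free0: "\<exists>f x. f \<in> mcarr (dual M) \<and> x \<in> mcarr M \<and> phi (f x) \<noteq> 0" if "refl_rank_one M" for M :: "('a, 'x) rmod"
    using free[OF that height_le_one_zero] by auto
  show ?thesis
  proof (intro conjI allI impI)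
    fix M :: "('a, 'm) rmod" assume M: "refl_rank_one M"
    obtain f x where "f \<in> mcarr (dual M)" "x \<in> mcarr M" "phi (f x) \<noteq> 0" using free0[OF M] by blast
    then show "refl_rank_one (cl_map phi M)" by (rule refl_rank_one_cl_map[OF hom noethB M])
  next
    fix M :: "('a, 'm) rmod" and M' :: "('a, 'n) rmod"
    assume "refl_rank_one M \<and> refl_rank_one M' \<and> mod_iso M M'"
    then show "mod_iso (cl_map phi M) (cl_map phi M')" by (intro mod_iso_cl_map refl_rank_oneD(1)) auto
  next
    fix M :: "('a, 'm) rmod" and N :: "('a, 'n) rmod"
    assume "refl_rank_one M \<and> refl_rank_one N"
    then have M: "refl_rank_one M" and N: "refl_rank_one N" by auto
    note Mmod = refl_rank_oneD(1)[OF M] and Nmod = refl_rank_oneD(1)[OF N]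
    note S = is_module_fun_mod[OF fun_submodule_semilinear] and B = is_module_fun_mod[OF fun_submodule_bilinear]
    let ?T = "bidual (tensor M N)" and ?T' = "dual (fun_mod (bilinear (\<lambda>r. r) M N))"
    let ?M = "cl_map phi M" and ?N = "cl_map phi N"
    have T: "is_module ?T" unfolding bidual_def by (rule is_module_dual)
    have T': "mod_iso ?T ?T'"
      unfolding bidual_def by (rule dual_iso[OF is_module_dual B dual_tensor[OF Mmod Nmod]])
    have semiT: "mod_iso (fun_mod (semilinear phi ?T)) (fun_mod (bilinear phi M N))"
      using semilinear_iso[OF T is_module_dual T'] semilinear_bidual_tensor[OF hom noethB normB M N free[OF M] free[OF N]]
      by (rule mod_iso_trans)
    have "mod_iso (cl_map phi ?T) (dual (fun_mod (semilinear phi ?T)))" by (rule cl_map_iso[OF T])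
    also have "mod_iso \<dots> (dual (fun_mod (bilinear phi M N)))" by (rule dual_iso[OF S B semiT])
    finally have lhs: "mod_iso (cl_map phi ?T) (dual (fun_mod (bilinear phi M N)))" .
    obtain f x g y where f: "f \<in> mcarr (dual M)" "x \<in> mcarr M" "phi (f x) \<noteq> 0"
      and g: "g \<in> mcarr (dual N)" "y \<in> mcarr N" "phi (g y) \<noteq> 0"
      using free0[OF M] free0[OF N] by blast
    have "mod_iso (dual (tensor ?M ?N)) (fun_mod (bilinear (\<lambda>r. r) ?M ?N))"
      by (rule dual_tensor[OF is_module_cl_map is_module_cl_map])
    also have "mod_iso \<dots> (fun_mod (bilinear (\<lambda>r. r) (dual (fun_mod (semilinear phi M))) (dual (fun_mod (semilinear phi N)))))"
      by (rule bilinear_iso[OF is_module_cl_map is_module_dual is_module_cl_map is_module_dual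
            cl_map_iso[OF Mmod] cl_map_iso[OF Nmod]])
    also have "mod_iso \<dots> (fun_mod (bilinear phi M N))"
      by (rule bilinear_dual_semilinear[OF hom M N f g])
    finally have "mod_iso (bidual (tensor ?M ?N)) (dual (fun_mod (bilinear phi M N)))"
      unfolding bidual_def by (rule dual_iso[OF is_module_dual B])
    then have "mod_iso (dual (fun_mod (bilinear phi M N))) (bidual (tensor ?M ?N))"
      by (rule mod_iso_sym[rotated]) (simp add: bidual_def is_module_dual)
    with lhs show "mod_iso (cl_map phi ?T) (bidual (tensor ?M ?N))" by (rule mod_iso_trans)
  qed
qed

end
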